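(* Let $d\ge1$ and $n\ge1$ be integers and let $a_1,\ldots,a_{2d}$ be integers with $\gcd(a_i,n)=1$ for all $i$ and $\sum_{i=1}^{2d}a_i/n\in\mathbb{Z}$ (i.e. $\mathbb{C}^{2d}/\mu_n$ of type $(a_1/n,\ldots,a_{2d}/n)$ is an isolated Gorenstein cyclic quotient singularity). Then the following are equivalent: (1) the minimal log-discrepancy of $(a_1/n,\ldots,a_{2d}/n)$ is at least $d$, i.e. $\sum_{i=1}^{2d}\{ta_i/n\}\ge d$ for all $t=1,\ldots,n-1$; (2) after reordering the $a_i$, one has $a_{2i-1}\equiv -a_{2i}\pmod n$ for all $i=1,\ldots,d$.
   Context: The cyclic quotient singularity of type $(a_1/n,\ldots,a_m/n)$ is $\mathbb{C}^m/\mu_n$ where $\zeta\in\mu_n$ acts by $(x_1,\ldots,x_m)\mapsto(\zeta^{a_1}x_1,\ldots,\zeta^{a_m}x_m)$. Its minimal log-discrepancy is $\min\{\sum_{i=1}^m\{ta_i/n\}: t=1,\ldots,n-1\}$, where $\{x\}=x-\lfloor x\rfloor$. It is isolated iff $\gcd(a_i,n)=1$ for all $i$, and Gorenstein iff $\sum_i a_i/n\in\mathbb{Z}$. *)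

theory Defs
  imports
    Complex_Main
    "HOL-Library.Extended_Real"
    "HOL-Combinatorics.Permutations"
    "HOL-Number_Theory.Cong"
begin

(* Minimal log-discrepancy of the cyclic quotient singularity of type
   (a 1 / n, ..., a m / n). It is extended-real valued so that the minimum over the
   empty range of t, i.e. for n = 1, is \<infinity> and bounds from below hold vacuously. *)
definition min_log_discrepancy :: "nat \<Rightarrow> nat \<Rightarrow> (nat \<Rightarrow> int) \<Rightarrow> ereal" where
  "min_log_discrepancy m n a =
     (INF t\<in>{1..n - 1}. ereal (\<Sum>i = 1..m. frac (real t * real_of_int (a i) / real n)))"

lemma le_min_log_discrepancy_iff:
  "ereal c \<le> min_log_discrepancy m n a \<longleftrightarrow>
     (\<forall>t\<in>{1..n - 1}. c \<le> (\<Sum>i = 1..m. frac (real t * real_of_int (a i) / real n)))"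
  by (simp add: min_log_discrepancy_def le_INF_iff)

lemma min_log_discrepancy_eq_Min:
  assumes "n \<ge> 2"
  shows "min_log_discrepancy m n a =
    ereal (Min ((\<lambda>t. \<Sum>i = 1..m. frac (real t * real_of_int (a i) / real n)) ` {1..n - 1}))"
proof -
  let ?f = "\<lambda>t. \<Sum>i = 1..m. frac (real t * real_of_int (a i) / real n)"
  have ne: "{1..n - 1} \<noteq> {}" using assms by simp
  have "Min (?f ` {1..n - 1}) \<in> ?f ` {1..n - 1}"
    using ne by (intro Min_in) auto
  then obtain t where t: "t \<in> {1..n - 1}" "Min (?f ` {1..n - 1}) = ?f t" by blast
  show ?thesis
  proof (rule antisym)
    show "min_log_discrepancy m n a \<le> ereal (Min (?f ` {1..n - 1}))"
      unfolding min_log_discrepancy_def t(2) using t(1) by (rule INF_lower)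
    show "ereal (Min (?f ` {1..n - 1})) \<le> min_log_discrepancy m n a"
      unfolding le_min_log_discrepancy_iff by (intro ballI Min_le) auto
  qed
qed

end

theory Submission
  imports Defs "HOL-Analysis.Analysis" "HOL-Number_Theory.Residues"
begin

text \<open>
  Replacing $t$ by $n-t$ turns the bound into the equality $\sum_i (1/2 - \{ta_i/n\}) = 0$ for all
  $t \not\equiv 0$. Hence the odd function $h(c) = \#\{i : a_i \equiv c\} - \#\{i : a_i \equiv -c\}$
  on the units modulo $n$ satisfies $\sum_c h(c)(1/2 - \{tc/n\}) = 0$ for all $t \not\equiv 0$, and
  the pairing exists iff $h = 0$. The functions with these properties form a space invariant under
  multiplication of the argument by units, so if $h \neq 0$ this space contains a Dirichlet
  character $\psi$, and $\psi$ is odd. Inserting the Fourier series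
  $\pi(1/2 - \{x\}) = \sum_k \sin(2\pi kx)/k$ and summing over $t$ with the weights
  $\sin(2\pi t/n)$ yields $L(1,\overline\psi) = 0$; no Gauss sums, hence no primitive characters, are
  needed. This contradicts $L(1,\chi) \neq 0$, which is shown by the $3$-$4$-$1$ inequality if
  $\chi^2$ is not principal, and by Monsky's Lambert series argument if $\chi$ is real.
\<close>

section \<open>Summation by parts and Dirichlet characters\<close>

text \<open>For an imprimitive character a single sawtooth relation only yields the L-value times
  Euler factors at primes dividing n, and these factors may vanish. Having the relation for every t
  not divisible by n avoids this, since the sine relations can then be inverted modulo n: the sum
  over t of sin(2 pi t/n) sin(2 pi t m/n) is n/2 times the indicator of m = 1 minus that of m = -1
  (mod n). With m = k a, the k-th Fourier term selects the residues a with k a = 1 and k a = -1.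
  Oddness of \<psi> makes the two contributions add up to n times the conjugate of \<psi> k, whence
  the conjugate character in L(1). The Fourier series and the series for L(1) converge only
  conditionally, so the identity is formed with powers of some r < 1 as damping factors before r
  tends to 1; summation by parts controls this limit on the L-series side, the complex logarithm on
  the sawtooth side. The nonvanishing of L(1) uses only real s > 1 and the value at 1, without
  analytic continuation.\<close>

lemma sum_scaleR_by_parts:
  fixes c :: "nat \<Rightarrow> 'a::real_vector"
  shows "(\<Sum>k<N. w k *\<^sub>R c k) =
    w N *\<^sub>R (\<Sum>k<N. c k) + (\<Sum>k<N. (w k - w (Suc k)) *\<^sub>R (\<Sum>j<Suc k. c j))"
proof (induction N)
  case (Suc N)
  then show ?case
    by (simp only: sum.lessThan_Suc) (simp add: scaleR_left_diff_distrib scaleR_right_distrib)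
qed simp

text \<open>Abel's inequality: after summation by parts the coefficients \<open>w N\<close> and
  \<open>w k - w (Suc k)\<close> are nonnegative and add up to \<open>w 0\<close>.\<close>

lemma norm_sum_scaleR_decseq_le:
  fixes c :: "nat \<Rightarrow> 'a::real_normed_vector"
  assumes c: "\<And>N. norm (\<Sum>k<N. c k) \<le> B" and w: "decseq w" "\<And>k. 0 \<le> w k"
  shows "norm (\<Sum>k<N. w k *\<^sub>R c k) \<le> B * w 0"
proof -
  have "norm (\<Sum>k<N. w k *\<^sub>R c k) \<le> norm (w N *\<^sub>R (\<Sum>k<N. c k)) +
      (\<Sum>k<N. norm ((w k - w (Suc k)) *\<^sub>R (\<Sum>j<Suc k. c j)))"
    unfolding sum_scaleR_by_parts[of w c N]
    by (intro order.trans[OF norm_triangle_ineq] add_left_mono norm_sum)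
  also have "\<dots> \<le> w N * B + (\<Sum>k<N. (w k - w (Suc k)) * B)"
  proof (intro add_mono sum_mono)
    show "norm (w N *\<^sub>R (\<Sum>k<N. c k)) \<le> w N * B"
      using w(2)[of N] c[of N] by (simp add: mult_left_mono)
    show "norm ((w k - w (Suc k)) *\<^sub>R (\<Sum>j<Suc k. c j)) \<le> (w k - w (Suc k)) * B" for k
      using decseq_SucD[OF w(1), of k] c[of "Suc k"] by (simp add: mult_left_mono del: sum.lessThan_Suc)
  qed
  also have "\<dots> = B * w 0"
    unfolding sum_distrib_right[symmetric] sum_lessThan_telescope' by (simp add: algebra_simps)
  finally show ?thesis .
qed

text \<open>A block is a difference of two partial sums; this is the origin of the factor 2 in all
  tail bounds below.\<close>

lemma norm_sum_shift_le:
  fixes c :: "nat \<Rightarrow> 'a::real_normed_vector"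
  assumes "\<And>N. norm (\<Sum>k<N. c k) \<le> B"
  shows "norm (\<Sum>k<N. c (k + m)) \<le> 2 * B"
proof -
  have "(\<Sum>k<m + N. c k) = (\<Sum>k<m. c k) + (\<Sum>k<N. c (k + m))"
    by (induction N) (simp_all add: add.assoc add.commute[of m])
  then have "(\<Sum>k<N. c (k + m)) = (\<Sum>k<m + N. c k) - (\<Sum>k<m. c k)" by simp
  then show ?thesis
    using norm_triangle_ineq4[of "\<Sum>k<m + N. c k" "\<Sum>k<m. c k"] assms[of "m + N"] assms[of m] by simp
qed

lemma summable_scaleR_decseq:
  fixes c :: "nat \<Rightarrow> 'a::banach"
  assumes c: "\<And>N. norm (\<Sum>k<N. c k) \<le> B" and w: "decseq w" "w \<longlonglongrightarrow> 0"
  shows "summable (\<lambda>k. w k *\<^sub>R c k)"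
proof -
  have pos: "0 \<le> w k" for k using decseq_ge[OF w] .
  have B: "0 \<le> B" using c[of 0] by simp
  have tail: "norm (\<Sum>k=m..<N. w k *\<^sub>R c k) \<le> 2 * B * w m" for m N
  proof (cases "m \<le> N")
    case True
    have "(\<Sum>k=m..<N. w k *\<^sub>R c k) = (\<Sum>k<N - m. w (k + m) *\<^sub>R c (k + m))"
      using True sum.shift_bounds_nat_ivl[of "\<lambda>k. w k *\<^sub>R c k" 0 m "N - m"]
      by (simp add: atLeast0LessThan)
    also have "norm \<dots> \<le> 2 * B * w (0 + m)"
      by (rule norm_sum_scaleR_decseq_le[where w = "\<lambda>k. w (k + m)"])
        (use w(1) pos in \<open>auto intro: norm_sum_shift_le[OF c] simp: decseq_def\<close>)
    finally show ?thesis by simp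
  qed (use B pos in simp)
  show ?thesis
    unfolding summable_Cauchy
  proof (intro allI impI)
    fix e :: real assume e: "e > 0"
    have "(\<lambda>m. 2 * B * w m) \<longlonglongrightarrow> 0" using tendsto_mult_left[OF w(2), of "2 * B"] by simp
    then obtain M where M: "\<And>m. m \<ge> M \<Longrightarrow> 2 * B * w m < e"
      using order_tendstoD(2)[OF _ e] by (metis eventually_sequentially)
    show "\<exists>N. \<forall>m\<ge>N. \<forall>n. norm (\<Sum>k=m..<n. w k *\<^sub>R c k) < e"
      by (intro exI[of _ M] allI impI order.strict_trans1[OF tail M])
  qed
qed

text \<open>Abel's inequality in the limit. The second bound depends on the weights only through
  \<open>w m\<close>, so it gives convergence uniformly in families of weights.\<close>

lemma norm_suminf_scaleR_decseq_le:
  fixes c :: "nat \<Rightarrow> 'a::banach"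
  assumes c: "\<And>N. norm (\<Sum>k<N. c k) \<le> B" and w: "decseq w" "w \<longlonglongrightarrow> 0"
  shows "norm (\<Sum>k. w k *\<^sub>R c k) \<le> B * w 0"
    and "norm (\<Sum>k. w (k + m) *\<^sub>R c (k + m)) \<le> 2 * B * w m"
proof -
  have main: "norm (\<Sum>k. u k *\<^sub>R b k) \<le> C * u 0"
    if "\<And>N. norm (\<Sum>k<N. b k) \<le> C" "decseq u" "u \<longlonglongrightarrow> 0" for u and b :: "nat \<Rightarrow> 'a" and C
  proof -
    have "(\<lambda>N. \<Sum>k<N. u k *\<^sub>R b k) \<longlonglongrightarrow> (\<Sum>k. u k *\<^sub>R b k)"
      using summable_LIMSEQ[OF summable_scaleR_decseq[OF that]] .
    moreover have "norm (\<Sum>k<N. u k *\<^sub>R b k) \<le> C * u 0" for N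
      by (rule norm_sum_scaleR_decseq_le) (use that decseq_ge in auto)
    ultimately show ?thesis by (intro Lim_norm_ubound[OF sequentially_bot]) auto
  qed
  show "norm (\<Sum>k. w k *\<^sub>R c k) \<le> B * w 0" by (rule main[OF assms])
  show "norm (\<Sum>k. w (k + m) *\<^sub>R c (k + m)) \<le> 2 * B * w m"
    using main[of "\<lambda>k. c (k + m)" "2 * B" "\<lambda>k. w (k + m)"] norm_sum_shift_le[OF c] w
    by (auto simp: decseq_def LIMSEQ_ignore_initial_segment)
qed

text \<open>A character of the unit group modulo n, extended by zero and lifted to the naturals.
  Primitivity is not demanded.\<close>

locale dirichlet_character =
  fixes n :: nat and \<psi> :: "nat \<Rightarrow> complex"
  assumes modulus_pos: "n > 0"
    and one: "\<psi> 1 = 1"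
    and mult: "\<psi> (j * k) = \<psi> j * \<psi> k"
    and periodic: "\<psi> (k + n) = \<psi> k"
    and zero: "\<not> coprime k n \<Longrightarrow> \<psi> k = 0"
begin

lemma power: "\<psi> (k ^ j) = \<psi> k ^ j"
  by (induction j) (use one mult in auto)

lemma add_mult_period: "\<psi> (k + j * n) = \<psi> k"
proof (induction j)
  case (Suc j)
  then show ?case using periodic[of "k + j * n"] by (simp add: add.assoc add.commute[of n])
qed simp

lemma mod_period: "\<psi> (k mod n) = \<psi> k"
  using add_mult_period[of "k mod n" "k div n"] by simp

lemma cong: "[j = k] (mod n) \<Longrightarrow> \<psi> j = \<psi> k"
  using mod_period[of j] mod_period[of k] by (simp add: Cong.cong_def)

lemma power_totient:
  assumes "coprime k n"
  shows "\<psi> k ^ totient n = 1"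
proof -
  have "\<psi> (k ^ totient n) = \<psi> 1" by (rule cong[OF euler_theorem[OF assms]])
  then show ?thesis by (simp only: one power)
qed

lemma norm_eq_1: "coprime k n \<Longrightarrow> norm (\<psi> k) = 1"
  using power_eq_1_iff[OF power_totient] modulus_pos by simp

lemma norm_le_1: "norm (\<psi> k) \<le> 1"
  using norm_eq_1[of k] zero[of k] by (cases "coprime k n") auto

end

locale nonprincipal_character = dirichlet_character +
  assumes nonprincipal: "\<exists>k. coprime k n \<and> \<psi> k \<noteq> 1"
begin

lemma modulus_gt_1: "n > 1"
proof (rule ccontr)
  assume "\<not> n > 1"
  then have "n = 1" using modulus_pos by simp
  then have "\<psi> k = 1" for k using cong[of k 1] one by (simp add: Cong.cong_def)
  then show False using nonprincipal by blast
qed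

lemma psi_0: "\<psi> 0 = 0"
  using modulus_gt_1 by (intro zero) simp

text \<open>Multiplication by a unit a with \<open>\<psi> a \<noteq> 1\<close> permutes the
  residues, so the sum equals \<open>\<psi> a\<close> times itself.\<close>

lemma sum_period: "(\<Sum>k<n. \<psi> k) = 0"
proof -
  obtain a where a: "coprime a n" "\<psi> a \<noteq> 1" using nonprincipal by blast
  have inj: "inj_on (\<lambda>k. a * k mod n) {..<n}"
  proof (rule inj_onI)
    fix x y assume xy: "x \<in> {..<n}" "y \<in> {..<n}" "a * x mod n = a * y mod n"
    then have "[x = y] (mod n)"
      using a(1) cong_mult_lcancel_nat[of a n x y] by (metis Cong.cong_def)
    then show "x = y" using xy by (simp add: Cong.cong_def)
  qed
  have "(\<lambda>k. a * k mod n) ` {..<n} = {..<n}"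
    by (rule endo_inj_surj[OF _ _ inj]) (use modulus_pos in auto)
  then have "(\<Sum>k<n. \<psi> k) = (\<Sum>k<n. \<psi> (a * k mod n))"
    using sum.reindex[OF inj, of \<psi>] by (simp add: o_def)
  also have "\<dots> = \<psi> a * (\<Sum>k<n. \<psi> k)"
    by (simp add: mod_period mult sum_distrib_left)
  finally show ?thesis using a(2) by simp
qed

text \<open>Full periods cancel, leaving fewer than n terms of norm at most 1. This is the constant
  B that Abel's inequality receives for every nonprincipal character.\<close>

lemma norm_sum_le: "norm (\<Sum>k<N. \<psi> (Suc k)) \<le> n"
proof -
  have per: "(\<Sum>k<N + n. \<psi> k) = (\<Sum>k<N. \<psi> k)" for N
    by (induction N) (use sum_period periodic in auto)
  have "norm (\<Sum>k<N. \<psi> k) \<le> n" for N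
  proof (induction N rule: less_induct)
    case (less N)
    show ?case
    proof (cases "N < n")
      case True
      have "norm (\<Sum>k<N. \<psi> k) \<le> (\<Sum>k<N. 1)"
        by (intro order.trans[OF norm_sum] sum_mono norm_le_1)
      then show ?thesis using True by simp
    next
      case False
      then show ?thesis using less[of "N - n"] per[of "N - n"] modulus_pos by simp
    qed
  qed
  from this[of "Suc N"] show ?thesis
    by (simp add: sum.lessThan_Suc_shift psi_0 del: sum.lessThan_Suc)
qed

end

section \<open>Nonvanishing at 1 for real characters\<close>

text \<open>A divisor of \<open>p ^ a * m\<close> is uniquely \<open>p ^ i * d\<close> with
  \<open>d dvd m\<close>, because the multiplicity of p recovers i.\<close>

lemma sum_divisors_prime_power_mult:
  fixes g :: "nat \<Rightarrow> real"
  assumes mult: "\<And>j k. g (j * k) = g j * g k" and one: "g 1 = 1"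
    and p: "prime p" "\<not> p dvd m" and m: "m > 0"
  shows "(\<Sum>d | d dvd p ^ a * m. g d) = (\<Sum>i\<le>a. g p ^ i) * (\<Sum>d | d dvd m. g d)"
proof -
  have pow: "g (p ^ i) = g p ^ i" for i by (induction i) (use mult one in auto)
  let ?f = "\<lambda>(i, d). p ^ i * d"
  have mp: "multiplicity p (p ^ i * d) = i" if "d dvd m" for i d
  proof (rule multiplicity_eqI)
    show "\<not> p ^ Suc i dvd p ^ i * d"
      using p that dvd_trans[of p d m] prime_gt_0_nat[of p] by auto
  qed simp
  have inj: "inj_on ?f ({..a} \<times> {d. d dvd m})"
  proof (rule inj_onI, clarsimp)
    fix i d j e assume *: "d dvd m" "e dvd m" "p ^ i * d = p ^ j * e"
    then have "i = j" using mp[of d i] mp[of e j] by simp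
    then show "i = j \<and> d = e" using * p(1) by (auto simp: prime_gt_0_nat)
  qed
  have img: "?f ` ({..a} \<times> {d. d dvd m}) = {d. d dvd p ^ a * m}"
  proof (intro equalityI subsetI)
    fix x assume "x \<in> {d. d dvd p ^ a * m}"
    then obtain b c where "x = b * c" "b dvd p ^ a" "c dvd m"
      using division_decomp by blast
    then show "x \<in> ?f ` ({..a} \<times> {d. d dvd m})"
      using p(1) by (auto simp: divides_primepow_nat image_iff)
  next
    fix x assume "x \<in> ?f ` ({..a} \<times> {d. d dvd m})"
    then show "x \<in> {d. d dvd p ^ a * m}"
      by (auto intro!: mult_dvd_mono le_imp_power_dvd)
  qed
  have "(\<Sum>d | d dvd p ^ a * m. g d) = (\<Sum>x\<in>{..a} \<times> {d. d dvd m}. g (?f x))"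
    unfolding img[symmetric] using sum.reindex[OF inj, of g] by (simp add: o_def)
  also have "\<dots> = (\<Sum>x\<in>{..a} \<times> {d. d dvd m}. case x of (i, d) \<Rightarrow> g p ^ i * g d)"
    by (intro sum.cong) (auto simp: mult pow)
  also have "\<dots> = (\<Sum>i\<le>a. g p ^ i) * (\<Sum>d | d dvd m. g d)"
    by (simp add: sum.cartesian_product[symmetric] sum_product)
  finally show ?thesis .
qed

text \<open>Splitting off one prime power at a time leaves the factors 1 + g p + ... + (g p)^a. Only
  \<open>g p = -1\<close> needs care, where the alternating sum is 0 or 1.\<close>

lemma sum_divisors_nonneg:
  fixes g :: "nat \<Rightarrow> real"
  assumes mult: "\<And>j k. g (j * k) = g j * g k" and one: "g 1 = 1"
    and vals: "\<And>k. g k \<in> {-1, 0, 1}" and m: "m > 0"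
  shows "(\<Sum>d | d dvd m. g d) \<ge> 0"
  using m
proof (induction m rule: less_induct)
  case (less m)
  show ?case
  proof (cases "m = 1")
    case True
    then show ?thesis using one by simp
  next
    case False
    then obtain p where p: "prime p" "p dvd m" using prime_factor_nat by blast
    obtain m' where m': "m = p ^ multiplicity p m * m'" "\<not> p dvd m'"
      using multiplicity_decompose'[of m p] p less.prems by (metis not_prime_unit not_gr0)
    define a where "a = multiplicity p m"
    have a: "a > 0" unfolding a_def using p less.prems by (simp add: prime_multiplicity_gt_zero_iff)
    have m'0: "m' > 0" using m' less.prems by (cases m') auto
    have "1 < p ^ a" using a prime_gt_1_nat[OF p(1)] by (simp only: one_less_power)
    then have "m' < p ^ a * m'" using m'0 by simp
    then have IH: "(\<Sum>d | d dvd m'. g d) \<ge> 0" using less.IH[of m'] m'(1) m'0 a_def by simp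
    have "(\<Sum>i\<le>a. g p ^ i) \<ge> 0"
    proof (cases "g p = -1")
      case True
      then show ?thesis
        by (cases "even a") (simp_all add: sum_gp0)
    next
      case False
      then show ?thesis using vals[of p] by (intro sum_nonneg) auto
    qed
    then show ?thesis
      using m'(1) IH sum_divisors_prime_power_mult[OF mult one p(1) m'(2) m'0, of a]
      by (simp add: a_def)
  qed
qed

text \<open>AM-GM for the i-th term and the i-th term from the end, whose product is always
  \<open>u ^ (K - 1)\<close> squared.\<close>

lemma sum_powers_ge:
  fixes u :: real
  shows "(\<Sum>i<K. (u\<^sup>2) ^ i) \<ge> real K * u ^ (K - 1)"
proof -
  have "2 * (\<Sum>i<K. (u\<^sup>2) ^ i) = (\<Sum>i<K. (u\<^sup>2) ^ i) + (\<Sum>i<K. (u\<^sup>2) ^ (K - Suc i))"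
    by (simp add: sum.nat_diff_reindex)
  also have "\<dots> = (\<Sum>i<K. (u\<^sup>2) ^ i + (u\<^sup>2) ^ (K - Suc i))"
    by (simp add: sum.distrib)
  also have "\<dots> \<ge> (\<Sum>i<K. 2 * u ^ (K - 1))"
  proof (intro sum_mono)
    fix i assume "i \<in> {..<K}"
    then have "u ^ (K - 1) = u ^ i * u ^ (K - Suc i)" by (simp flip: power_add)
    then show "2 * u ^ (K - 1) \<le> (u\<^sup>2) ^ i + (u\<^sup>2) ^ (K - Suc i)"
      using sum_squares_bound[of "u ^ i" "u ^ (K - Suc i)"]
      by (simp add: power_mult[symmetric] mult.commute[of _ 2] mult.assoc)
  qed
  finally show ?thesis by simp
qed

text \<open>Summed against $\psi$, Monsky's weights give $L(1,\psi)/(1-t)$ minus the Lambert series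
  $\sum_k \psi(k) t^k/(1-t^k)$; their monotonicity bounds this difference as $t \to 1$.\<close>

lemma lambert_weights:
  fixes t :: real
  assumes t: "0 < t" "t < 1"
  defines "b \<equiv> \<lambda>k. 1 / ((1 - t) * real (Suc k)) - t ^ Suc k / (1 - t ^ Suc k)"
  shows "decseq b" "b \<longlonglongrightarrow> 0"
proof -
  define S where "S = (\<lambda>K. \<Sum>i<K. t ^ i)"
  have S: "1 - t ^ K = (1 - t) * S K" for K
    unfolding S_def by (simp add: one_diff_power_eq)
  have Spos: "S (Suc K) > 0" for K
    unfolding S_def using t by (intro sum_pos) auto
  show "decseq b"
  proof (rule decseq_SucI)
    fix k
    \<comment> \<open>Up to the factor 1 - t, the inequality \<open>b (Suc k) \<le> b k\<close>
      amounts to t^(k+1) (k+1)(k+2) \<le> S(k+1) S(k+2). The AM-GM bound with u = sqrt t estimates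
      the right-hand side from below by (k+1)(k+2) u^(2k+1), and t^(k+1) = u^(2k+2) is at most
      u^(2k+1).\<close>
    define u where "u = sqrt t"
    have u: "0 < u" "u \<le> 1" "u\<^sup>2 = t" using t by (simp_all add: u_def real_sqrt_le_1_iff)
    have "real (Suc k) * u ^ k * (real (Suc (Suc k)) * u ^ Suc k) \<le> S (Suc k) * S (Suc (Suc k))"
      using sum_powers_ge[where K = "Suc k" and u = u] sum_powers_ge[where K = "Suc (Suc k)" and u = u] u Spos[of k]
      by (intro mult_mono) (auto simp: S_def simp del: sum.lessThan_Suc intro: less_imp_le)
    moreover have "t ^ Suc k \<le> u ^ k * u ^ Suc k"
    proof -
      have "t ^ Suc k = u ^ k * u ^ Suc k * u" by (simp add: u(3)[symmetric] power2_eq_square power_mult_distrib)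
      also have "\<dots> \<le> u ^ k * u ^ Suc k * 1" using u by (intro mult_left_mono) auto
      finally show ?thesis by simp
    qed
    ultimately have key: "t ^ Suc k * (real (Suc k) * real (Suc (Suc k))) \<le> S (Suc k) * S (Suc (Suc k))"
      by (smt (verit, ccfv_SIG) mult.assoc mult.commute mult.left_commute mult_right_mono of_nat_0_le_iff mult_nonneg_nonneg)
    have St: "S (Suc (Suc k)) = 1 + t * S (Suc k)"
      unfolding S_def by (subst sum.lessThan_Suc_shift) (simp add: sum_distrib_left del: sum.lessThan_Suc)
    have "t ^ Suc k / S (Suc k) - t ^ Suc (Suc k) / S (Suc (Suc k)) =
        t ^ Suc k / (S (Suc k) * S (Suc (Suc k)))"
      using Spos[of k] Spos[of "Suc k"] St by (simp add: field_simps)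
    also have "\<dots> \<le> 1 / (real (Suc k) * real (Suc (Suc k)))"
      using key Spos[of k] Spos[of "Suc k"] by (simp add: divide_simps mult.commute)
    also have "\<dots> = 1 / real (Suc k) - 1 / real (Suc (Suc k))"
      by (simp add: field_simps)
    finally have "(1 / real (Suc (Suc k)) - t ^ Suc (Suc k) / S (Suc (Suc k))) / (1 - t)
        \<le> (1 / real (Suc k) - t ^ Suc k / S (Suc k)) / (1 - t)"
      using t by (intro divide_right_mono) auto
    then show "b (Suc k) \<le> b k"
      unfolding b_def S by (simp add: diff_divide_distrib mult.commute)
  qed
  have 1: "(\<lambda>k. t ^ Suc k) \<longlonglongrightarrow> 0"
    using LIMSEQ_Suc[OF LIMSEQ_power_zero[of t]] t by simp
  have "(\<lambda>k. 1 / (1 - t) * (1 / real (Suc k)) - t ^ Suc k / (1 - t ^ Suc k)) \<longlonglongrightarrow> 1 / (1 - t) * 0 - 0 / (1 - 0)"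
    using LIMSEQ_Suc[OF lim_1_over_n]
    by (intro tendsto_intros 1) auto
  then show "b \<longlonglongrightarrow> 0" by (simp add: b_def)
qed

text \<open>The quotient is the geometric series of \<open>t ^ m\<close> over all positive multiples
  m of d, so the difference is its tail, which starts at an exponent beyond M.\<close>

lemma sum_multiples_bounds:
  fixes t :: real
  assumes t: "0 < t" "t < 1" and d: "d > 0"
  shows "0 \<le> t ^ d / (1 - t ^ d) - (\<Sum>m | m \<in> {1..M} \<and> d dvd m. t ^ m)"
    "t ^ d / (1 - t ^ d) - (\<Sum>m | m \<in> {1..M} \<and> d dvd m. t ^ m) \<le> t ^ M / (1 - t)"
proof -
  let ?q = "M div d"
  have "{m. m \<in> {1..M} \<and> d dvd m} = (\<lambda>j. d * Suc j) ` {..<?q}"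
  proof (intro equalityI subsetI)
    fix m assume "m \<in> {m. m \<in> {1..M} \<and> d dvd m}"
    then obtain j where j: "m = d * j" "1 \<le> m" "m \<le> M" by auto
    then have "j > 0" by (cases j) auto
    moreover have "j \<le> ?q" using j d by (simp add: less_eq_div_iff_mult_less_eq mult.commute)
    ultimately show "m \<in> (\<lambda>j. d * Suc j) ` {..<?q}"
      using j by (intro image_eqI[of _ _ "j - 1"]) auto
  next
    fix m assume "m \<in> (\<lambda>j. d * Suc j) ` {..<?q}"
    then obtain j where j: "m = d * Suc j" "j < ?q" by auto
    then have "Suc j \<le> ?q" by simp
    then have "m \<le> M" unfolding j(1) using d by (metis less_eq_div_iff_mult_less_eq mult.commute)
    then show "m \<in> {m. m \<in> {1..M} \<and> d dvd m}" using j d by auto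
  qed
  moreover have "inj_on (\<lambda>j. d * Suc j) {..<?q}" using d by (auto intro!: inj_onI)
  ultimately have "(\<Sum>m | m \<in> {1..M} \<and> d dvd m. t ^ m) = (\<Sum>j<?q. t ^ (d * Suc j))"
    by (simp add: sum.reindex)
  also have "\<dots> = t ^ d * (\<Sum>j<?q. (t ^ d) ^ j)"
    by (simp add: sum_distrib_left power_add power_mult)
  also have "\<dots> = t ^ d * ((1 - (t ^ d) ^ ?q) / (1 - t ^ d))"
    using t d power_strict_decreasing[of 0 d t] by (simp add: sum_gp_strict)
  finally have eq: "t ^ d / (1 - t ^ d) - (\<Sum>m | m \<in> {1..M} \<and> d dvd m. t ^ m) =
      t ^ (d * Suc ?q) / (1 - t ^ d)"
    using t d power_strict_decreasing[of 0 d t] by (simp add: field_simps power_add power_mult)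
  have td: "t ^ d \<le> t" using t d power_decreasing[of 1 d t] by simp
  show "0 \<le> t ^ d / (1 - t ^ d) - (\<Sum>m | m \<in> {1..M} \<and> d dvd m. t ^ m)"
    unfolding eq using t td by (intro divide_nonneg_nonneg) auto
  have "M \<le> d * Suc ?q" using d dividend_less_times_div[of d M] by simp
  then have "t ^ (d * Suc ?q) \<le> t ^ M" using t by (intro power_decreasing) auto
  then show "t ^ d / (1 - t ^ d) - (\<Sum>m | m \<in> {1..M} \<and> d dvd m. t ^ m) \<le> t ^ M / (1 - t)"
    unfolding eq using t td by (intro frac_le) auto
qed

text \<open>The Lambert series rearrangement, truncated at M so that only finite sums are
  interchanged. Each of the M values of d costs an error of at most \<open>t ^ M / (1 - t)\<close>,
  and the total vanishes as M grows.\<close>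

lemma sum_divisor_sums_le:
  fixes t :: real and g :: "nat \<Rightarrow> real"
  assumes t: "0 < t" "t < 1" and g: "\<And>k. \<bar>g k\<bar> \<le> 1"
  shows "(\<Sum>m=1..M. (\<Sum>d | d dvd m. g d) * t ^ m) \<le>
    (\<Sum>k=1..M. g k * (t ^ k / (1 - t ^ k))) + real M * t ^ M / (1 - t)"
proof -
  have "(\<Sum>m=1..M. (\<Sum>d | d dvd m. g d) * t ^ m) = (\<Sum>m=1..M. \<Sum>d | d \<in> {1..M} \<and> d dvd m. g d * t ^ m)"
  proof (intro sum.cong refl)
    fix m assume m: "m \<in> {1..M}"
    then have "{d. d dvd m} = {d. d \<in> {1..M} \<and> d dvd m}"
      by (auto dest: dvd_imp_le intro: Suc_leI dvd_pos_nat)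
    then show "(\<Sum>d | d dvd m. g d) * t ^ m = (\<Sum>d | d \<in> {1..M} \<and> d dvd m. g d * t ^ m)"
      by (simp add: sum_distrib_right)
  qed
  also have "\<dots> = (\<Sum>d=1..M. \<Sum>m | m \<in> {1..M} \<and> d dvd m. g d * t ^ m)"
    by (rule sum.swap_restrict) auto
  also have "\<dots> = (\<Sum>d=1..M. g d * (\<Sum>m | m \<in> {1..M} \<and> d dvd m. t ^ m))"
    by (simp add: sum_distrib_left)
  also have "\<dots> \<le> (\<Sum>d=1..M. g d * (t ^ d / (1 - t ^ d)) + t ^ M / (1 - t))"
  proof (intro sum_mono)
    fix d assume d: "d \<in> {1..M}"
    define E where "E = t ^ d / (1 - t ^ d) - (\<Sum>m | m \<in> {1..M} \<and> d dvd m. t ^ m)"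
    have E: "0 \<le> E" "E \<le> t ^ M / (1 - t)"
      using sum_multiples_bounds[OF t, of d M] d by (auto simp: E_def)
    have "- g d * E \<le> 1 * E" using g[of d] E by (intro mult_right_mono) auto
    then have "g d * (t ^ d / (1 - t ^ d)) - g d * E \<le> g d * (t ^ d / (1 - t ^ d)) + t ^ M / (1 - t)"
      using E by simp
    then show "g d * (\<Sum>m | m \<in> {1..M} \<and> d dvd m. t ^ m) \<le> g d * (t ^ d / (1 - t ^ d)) + t ^ M / (1 - t)"
      by (simp add: E_def algebra_simps)
  qed
  finally show ?thesis by (simp add: sum.distrib)
qed

context nonprincipal_character
begin

definition L1 :: complex where "L1 = (\<Sum>k. (1 / real (Suc k)) *\<^sub>R \<psi> (Suc k))"

lemma summable_L1: "summable (\<lambda>k. (1 / real (Suc k)) *\<^sub>R \<psi> (Suc k))"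
  using LIMSEQ_Suc[OF lim_1_over_n]
  by (intro summable_scaleR_decseq[OF norm_sum_le]) (auto simp: decseq_def frac_le)

text \<open>If \<open>L1 = 0\<close>, the Lambert series of \<psi> is minus the series with weights
  \<open>b\<close>, hence bounded by n for all t in (0,1). As a power series its coefficients are
  the nonnegative divisor sums of g, and infinitely many of them are 1, so it must exceed every
  bound as t tends to 1.\<close>

lemma L1_nonzero_if_real:
  assumes real: "\<And>k. \<psi> k \<in> \<real>"
  shows "L1 \<noteq> 0"
proof
  assume L0: "L1 = 0"
  define g where "g = (\<lambda>k. Re (\<psi> k))"
  have psi: "\<psi> k = of_real (g k)" for k using real[of k] by (simp add: g_def)
  have g_mult: "g (j * k) = g j * g k" for j k
    using mult[of j k] by (simp add: psi flip: of_real_mult)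
  have g_one: "g 1 = 1" using one by (simp add: g_def)
  have g_abs: "\<bar>g k\<bar> \<le> 1" for k using norm_le_1[of k] by (simp add: psi)
  have g_vals: "g k \<in> {-1, 0, 1}" for k
  proof (cases "coprime k n")
    case True
    then have "\<bar>g k\<bar> = 1" using norm_eq_1[of k] by (simp add: psi)
    then show ?thesis by (auto simp: abs_if split: if_splits)
  next
    case False
    then show ?thesis using zero[of k] by (simp add: g_def)
  qed
  \<comment> \<open>At a prime dividing n the character vanishes, so every power of q has divisor
    sum exactly 1.\<close>
  obtain q where q: "prime q" "q dvd n" using prime_factor_nat[of n] modulus_gt_1 by auto
  have div_q: "(\<Sum>d | d dvd q ^ i. g d) = 1" for i
  proof -
    have "g q = 0"
      using zero[of q] q prime_gt_1_nat[OF q(1)] by (auto simp: g_def prime_imp_coprime_nat coprime_absorb_left)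
    then show ?thesis
      using sum_divisors_prime_power_mult[OF g_mult g_one q(1), of 1 i] q(1) prime_gt_1_nat[OF q(1)] g_one
      by (simp add: power_0_left sum.delta)
  qed
  have bound: "(\<Sum>i<I. t ^ (q ^ i)) \<le> n" if t: "0 < t" "t < 1" for t :: real and I
  proof -
    define b where "b = (\<lambda>k. 1 / ((1 - t) * real (Suc k)) - t ^ Suc k / (1 - t ^ Suc k))"
    note b = lambert_weights[OF t, folded b_def]
    \<comment> \<open>The first weight does not depend on t, so Abel's inequality gives a bound
      uniform in t.\<close>
    have b0: "b 0 = 1" using t by (simp add: b_def field_simps)
    have b_sums: "(\<lambda>k. b k *\<^sub>R \<psi> (Suc k)) sums (\<Sum>k. b k *\<^sub>R \<psi> (Suc k))"
      by (intro summable_sums summable_scaleR_decseq[OF norm_sum_le] b)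
    have b_le: "norm (\<Sum>k. b k *\<^sub>R \<psi> (Suc k)) \<le> n"
      using norm_suminf_scaleR_decseq_le(1)[OF norm_sum_le b] b0 by simp
    have "(\<lambda>k. (1 / real (Suc k)) *\<^sub>R \<psi> (Suc k)) sums 0"
      using summable_sums[OF summable_L1] L0 by (simp add: L1_def)
    from sums_diff[OF sums_scaleR_right[OF this, of "1 / (1 - t)"] b_sums]
    have "(\<lambda>k. (t ^ Suc k / (1 - t ^ Suc k)) *\<^sub>R \<psi> (Suc k)) sums (- (\<Sum>k. b k *\<^sub>R \<psi> (Suc k)))"
      by (simp add: b_def scaleR_left_diff_distrib)
    from sums_Re[OF this] have "(\<lambda>k. g (Suc k) * (t ^ Suc k / (1 - t ^ Suc k))) sums Re (- (\<Sum>k. b k *\<^sub>R \<psi> (Suc k)))"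
      by (simp add: psi mult.commute)
    then have lim1: "(\<lambda>M. \<Sum>k=1..M. g k * (t ^ k / (1 - t ^ k))) \<longlonglongrightarrow> Re (- (\<Sum>k. b k *\<^sub>R \<psi> (Suc k)))"
      unfolding sums_def by (simp only: One_nat_def sum.atLeast1_atMost_eq)
    have "(\<lambda>M. real M * t ^ M) \<longlonglongrightarrow> 0"
      using powser_times_n_limit_0[of t] t by simp
    from tendsto_add[OF lim1 tendsto_divide[OF this tendsto_const, of "1 - t"]]
    have "(\<lambda>M. (\<Sum>k=1..M. g k * (t ^ k / (1 - t ^ k))) + real M * t ^ M / (1 - t))
        \<longlonglongrightarrow> Re (- (\<Sum>k. b k *\<^sub>R \<psi> (Suc k)))" using t by simp
    moreover have "(\<Sum>i<I. t ^ (q ^ i)) \<le> (\<Sum>k=1..M. g k * (t ^ k / (1 - t ^ k))) + real M * t ^ M / (1 - t)"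
      if M: "M \<ge> q ^ I" for M
    proof -
      have sub: "(\<lambda>i. q ^ i) ` {..<I} \<subseteq> {1..M}"
      proof
        fix x assume "x \<in> (\<lambda>i. q ^ i) ` {..<I}"
        then obtain i where i: "x = q ^ i" "i < I" by auto
        moreover have "q ^ i \<le> q ^ I" using i prime_ge_1_nat[OF q(1)] by (intro power_increasing) auto
        ultimately show "x \<in> {1..M}" using M q(1) by (simp add: Suc_leI prime_gt_0_nat)
      qed
      have inj: "inj_on (\<lambda>i. q ^ i) {..<I}"
        using prime_gt_1_nat[OF q(1)] by (auto intro!: inj_onI simp: power_inject_exp)
      have "(\<Sum>i<I. t ^ (q ^ i)) = (\<Sum>m\<in>(\<lambda>i. q ^ i) ` {..<I}. (\<Sum>d | d dvd m. g d) * t ^ m)"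
        by (simp add: sum.reindex[OF inj] div_q)
      also have "\<dots> \<le> (\<Sum>m=1..M. (\<Sum>d | d dvd m. g d) * t ^ m)"
        using sum_divisors_nonneg[OF g_mult g_one g_vals] t
        by (intro sum_mono2 sub mult_nonneg_nonneg) auto
      also note sum_divisor_sums_le[OF t g_abs]
      finally show ?thesis .
    qed
    ultimately have "(\<Sum>i<I. t ^ (q ^ i)) \<le> Re (- (\<Sum>k. b k *\<^sub>R \<psi> (Suc k)))"
      by (intro tendsto_lowerbound[where F = sequentially]) (auto simp: eventually_sequentially)
    also have "\<dots> \<le> n" using complex_Re_le_cmod[of "- (\<Sum>k. b k *\<^sub>R \<psi> (Suc k))"] b_le by simp
    finally show ?thesis .
  qed
  \<comment> \<open>With n + 1 terms, each tending to 1, the limit n + 1 contradicts the bound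
    n.\<close>
  have "((\<lambda>t::real. \<Sum>i<Suc n. t ^ (q ^ i)) \<longlongrightarrow> (\<Sum>i<Suc n. 1 ^ (q ^ i))) (at_left 1)"
    by (intro tendsto_intros)
  moreover have "\<forall>\<^sub>F t::real in at_left 1. (\<Sum>i<Suc n. t ^ (q ^ i)) \<le> n"
    using bound eventually_at_left_real[of 0 1] by (auto elim!: eventually_mono simp del: sum.lessThan_Suc)
  ultimately have "(\<Sum>i<Suc n. 1 ^ (q ^ i)) \<le> real n"
    by (intro tendsto_upperbound) auto
  then show False by simp
qed

end

section \<open>Nonvanishing at 1 in general\<close>

text \<open>The sieve of Eratosthenes: among the integers A surviving the primes in P, the multiples
  of a new prime p are exactly p A. By multiplicativity they sum to \<open>f p\<close> times the sum
  over A, so removing them multiplies the sum by \<open>1 - f p\<close>.\<close>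

lemma euler_sieve:
  fixes f :: "nat \<Rightarrow> complex"
  assumes mult: "\<And>j k. f (j * k) = f j * f k"
    and summable: "(\<lambda>k. norm (f k)) summable_on UNIV"
    and P: "finite P" "\<And>p. p \<in> P \<Longrightarrow> prime p"
  shows "(\<Prod>p\<in>P. 1 - f p) * infsum f UNIV = infsum f {k. \<forall>p\<in>P. \<not> p dvd k}"
  using P
proof (induction P rule: finite_induct)
  case (insert p P)
  define A where "A = {k. \<forall>q\<in>P. \<not> q dvd k}"
  have sm: "f summable_on B" for B
    using abs_summable_summable summable summable_on_subset_banach by blast
  have p: "prime p" using insert.prems by simp
  have B: "(\<lambda>k. p * k) ` A = {k \<in> A. p dvd k}"
  proof (intro equalityI subsetI)
    fix x assume "x \<in> (\<lambda>k. p * k) ` A"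
    then obtain k where k: "x = p * k" "k \<in> A" by auto
    have "\<not> q dvd x" if q: "q \<in> P" for q
    proof
      assume "q dvd x"
      then have "q dvd p \<or> q dvd k"
        using k(1) insert.prems q by (auto simp: prime_dvd_mult_iff)
      moreover have "\<not> q dvd p"
        using insert.hyps q p insert.prems primes_dvd_imp_eq by blast
      ultimately show False using k(2) q by (auto simp: A_def)
    qed
    then show "x \<in> {k \<in> A. p dvd k}" using k by (auto simp: A_def)
  next
    fix x assume x: "x \<in> {k \<in> A. p dvd k}"
    then obtain k where k: "x = p * k" by auto
    then have "k \<in> A" using x by (auto simp: A_def)
    then show "x \<in> (\<lambda>k. p * k) ` A" using k by auto
  qed
  have inj: "inj_on (\<lambda>k. p * k) A" using prime_gt_0_nat[OF p] by (auto intro!: inj_onI)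
  have "infsum f {k \<in> A. p dvd k} = infsum (\<lambda>k. f (p * k)) A"
    unfolding B[symmetric] by (subst infsum_reindex[OF inj]) (simp add: o_def)
  also have "\<dots> = f p * infsum f A"
    unfolding mult using sm by (rule infsum_cmult_right)
  finally have 1: "infsum f {k \<in> A. p dvd k} = f p * infsum f A" .
  have "{k. \<forall>q\<in>insert p P. \<not> q dvd k} = A - {k \<in> A. p dvd k}" by (auto simp: A_def)
  then have "infsum f {k. \<forall>q\<in>insert p P. \<not> q dvd k} = infsum f A - infsum f {k \<in> A. p dvd k}"
    using infsum_Diff[OF sm sm, of "{k \<in> A. p dvd k}" A] by simp
  also have "\<dots> = (1 - f p) * infsum f A" by (simp add: 1 algebra_simps)
  also have "\<dots> = (1 - f p) * ((\<Prod>p\<in>P. 1 - f p) * infsum f UNIV)"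
    using insert.IH insert.prems by (simp add: A_def)
  finally show ?case using insert.hyps by (simp add: mult.assoc)
qed simp

text \<open>After sieving by the primes below N only 1 and integers of size at least N survive, so
  the distance to 1 is at most a tail of the absolutely convergent sum. In this form no Euler factor
  has to be inverted.\<close>

lemma euler_product_tendsto:
  fixes f :: "nat \<Rightarrow> complex"
  assumes mult: "\<And>j k. f (j * k) = f j * f k" and one: "f 1 = 1"
    and summable: "(\<lambda>k. norm (f k)) summable_on UNIV"
  shows "(\<lambda>N. (\<Prod>p | prime p \<and> p < N. 1 - f p) * infsum f UNIV) \<longlonglongrightarrow> 1"
proof -
  have sm: "f summable_on B" for B
    using abs_summable_summable summable summable_on_subset_banach by blast
  have smn: "(\<lambda>k. norm (f k)) summable_on B" for B
    using summable summable_on_subset_banach by blast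
  have bound: "norm ((\<Prod>p | prime p \<and> p < N. 1 - f p) * infsum f UNIV - 1)
      \<le> (\<Sum>\<^sub>\<infinity>k. norm (f k)) - (\<Sum>k<N. norm (f k))" if N: "N > 2" for N
  proof -
    define A where "A = {k. \<forall>p\<in>{p. prime p \<and> p < N}. \<not> p dvd k}"
    have 1: "1 \<in> A" by (auto simp: A_def)
    have sub: "A - {1} \<subseteq> UNIV - {..<N}"
    proof
      fix k assume k: "k \<in> A - {1}"
      then obtain p where p: "prime p" "p dvd k" using prime_factor_nat[of k] by auto
      then have "p \<ge> N" using k by (auto simp: A_def not_less)
      \<comment> \<open>For N > 2 the prime 2 is among the sieving primes; this is what removes 0,
        which every prime divides.\<close>
      moreover have "\<not> 2 dvd k" using k N two_is_prime_nat by (auto simp: A_def)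
      then have "k \<noteq> 0" by (metis dvd_0_right)
      ultimately show "k \<in> UNIV - {..<N}" using p dvd_imp_le[of p k] by auto
    qed
    have "(\<Prod>p | prime p \<and> p < N. 1 - f p) * infsum f UNIV - 1 = infsum f A - infsum f {1}"
      unfolding A_def using one by (subst euler_sieve[OF mult summable]) auto
    also have "\<dots> = infsum f (A - {1})"
      using 1 by (subst infsum_Diff[OF sm sm]) auto
    also have "norm \<dots> \<le> (\<Sum>\<^sub>\<infinity>k\<in>A - {1}. norm (f k))"
      by (rule norm_infsum_bound[OF smn])
    also have "\<dots> \<le> (\<Sum>\<^sub>\<infinity>k\<in>UNIV - {..<N}. norm (f k))"
      by (rule infsum_mono2[OF smn smn sub]) auto
    also have "\<dots> = (\<Sum>\<^sub>\<infinity>k. norm (f k)) - (\<Sum>k<N. norm (f k))"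
      by (subst infsum_Diff[OF smn smn]) auto
    finally show ?thesis .
  qed
  have "(\<lambda>N. \<Sum>k<N. norm (f k)) \<longlonglongrightarrow> (\<Sum>\<^sub>\<infinity>k. norm (f k))"
    using has_sum_imp_sums[OF has_sum_infsum[OF smn]] by (simp add: sums_def)
  from tendsto_diff[OF tendsto_const[of "\<Sum>\<^sub>\<infinity>k. norm (f k)"] this]
  have "(\<lambda>N. (\<Sum>\<^sub>\<infinity>k. norm (f k)) - (\<Sum>k<N. norm (f k))) \<longlonglongrightarrow> 0" by simp
  moreover have "\<forall>\<^sub>F N in sequentially. norm ((\<Prod>p | prime p \<and> p < N. 1 - f p) * infsum f UNIV - 1)
      \<le> (\<Sum>\<^sub>\<infinity>k. norm (f k)) - (\<Sum>k<N. norm (f k))"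
    using eventually_gt_at_top[of "2::nat"] by (rule eventually_mono) (rule bound)
  ultimately have "(\<lambda>N. (\<Prod>p | prime p \<and> p < N. 1 - f p) * infsum f UNIV - 1) \<longlonglongrightarrow> 0"
    by (rule Lim_null_comparison[rotated])
  then show ?thesis by (rule LIM_zero_cancel)
qed

text \<open>Replaces a logarithm of the Euler factor: the first-order term is exact and the error
  \<open>x\<^sup>2\<close> will be summable over primes.\<close>

lemma norm_euler_factor_le:
  assumes "norm z \<le> 1"
  shows "(norm (1 - complex_of_real x * z))\<^sup>2 \<le> exp (x\<^sup>2 - 2 * x * Re z)"
proof -
  have "(norm (1 - complex_of_real x * z))\<^sup>2 = 1 - 2 * x * Re z + x\<^sup>2 * (norm z)\<^sup>2"
    unfolding cmod_power2 by (simp add: power2_eq_square algebra_simps)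
  also have "x\<^sup>2 * (norm z)\<^sup>2 \<le> x\<^sup>2 * 1"
    using assms by (intro mult_left_mono) (auto simp: power_le_one)
  also have "1 - 2 * x * Re z + x\<^sup>2 * 1 \<le> exp (x\<^sup>2 - 2 * x * Re z)"
    using exp_ge_add_one_self[of "x\<^sup>2 - 2 * x * Re z"] by linarith
  finally show ?thesis by simp
qed

text \<open>Both bounds follow from 1 + y \<le> exp y together with 1/(x+1) \<le> ln(1 + 1/x) \<le>
  1/x. The first makes the sum of k^(-1-\<delta>) telescope; the second controls the increments of
  the weights k^(-\<delta>).\<close>

lemma powr_diff_bounds:
  fixes x \<delta> :: real
  assumes x: "x \<ge> 1" and \<delta>: "\<delta> > 0"
  shows "\<delta> * (x + 1) powr (- 1 - \<delta>) \<le> x powr (- \<delta>) - (x + 1) powr (- \<delta>)"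
    and "x powr (- \<delta>) - (x + 1) powr (- \<delta>) \<le> \<delta> / x"
proof -
  have "x * (1 + 1 / x) = x + 1" using x by (simp add: field_simps)
  then have ln_split: "ln (x + 1) = ln x + ln (1 + 1 / x)"
    using x ln_mult_pos[of x "1 + 1 / x"] by (simp add: add_pos_pos)
  have "x powr (- \<delta>) = (x + 1) powr (- \<delta>) * exp (\<delta> * ln (1 + 1 / x))"
    using x by (simp add: powr_def ln_split distrib_left flip: exp_add)
  moreover have "1 + \<delta> * (1 / (x + 1)) \<le> exp (\<delta> * ln (1 + 1 / x))"
  proof -
    have "ln (1 - 1 / (x + 1)) \<le> - (1 / (x + 1))"
      using ln_le_minus_one[of "1 - 1 / (x + 1)"] x by simp
    moreover have "1 - 1 / (x + 1) = inverse (1 + 1 / x)" using x by (simp add: field_simps)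
    ultimately have "1 / (x + 1) \<le> ln (1 + 1 / x)" using x by (simp add: ln_inverse add_pos_pos)
    then have "\<delta> * (1 / (x + 1)) \<le> \<delta> * ln (1 + 1 / x)" using \<delta> by (intro mult_left_mono) auto
    then show ?thesis using exp_ge_add_one_self[of "\<delta> * ln (1 + 1 / x)"] by linarith
  qed
  ultimately have "(x + 1) powr (- \<delta>) * (1 + \<delta> * (1 / (x + 1))) \<le> x powr (- \<delta>)"
    by (simp add: mult_left_mono)
  moreover have "(x + 1) powr (- 1 - \<delta>) = (x + 1) powr (- \<delta>) * (1 / (x + 1))"
    using x by (simp add: powr_diff powr_minus_divide)
  ultimately show "\<delta> * (x + 1) powr (- 1 - \<delta>) \<le> x powr (- \<delta>) - (x + 1) powr (- \<delta>)"
    by (simp add: algebra_simps)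
  have "(x + 1) powr (- \<delta>) = x powr (- \<delta>) * exp (- \<delta> * ln (1 + 1 / x))"
    using x by (simp add: powr_def ln_split distrib_left flip: exp_add)
  moreover have "1 - \<delta> * (1 / x) \<le> exp (- \<delta> * ln (1 + 1 / x))"
  proof -
    have "ln (1 + 1 / x) \<le> 1 / x" using x by (intro ln_add_one_self_le_self) auto
    then have "\<delta> * ln (1 + 1 / x) \<le> \<delta> * (1 / x)" using \<delta> by (intro mult_left_mono) auto
    then show ?thesis using exp_ge_add_one_self[of "- \<delta> * ln (1 + 1 / x)"] by linarith
  qed
  ultimately have "x powr (- \<delta>) * (1 - \<delta> * (1 / x)) \<le> (x + 1) powr (- \<delta>)"
    by (simp add: mult_left_mono)
  then have "x powr (- \<delta>) - (x + 1) powr (- \<delta>) \<le> x powr (- \<delta>) * (\<delta> / x)"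
    by (simp add: algebra_simps)
  also have "\<dots> \<le> 1 * (\<delta> / x)"
    using x \<delta> by (intro mult_right_mono) (auto simp: powr_minus ge_one_powr_ge_zero inverse_le_1_iff)
  finally show "x powr (- \<delta>) - (x + 1) powr (- \<delta>) \<le> \<delta> / x" by simp
qed

lemma sum_powr_le:
  fixes \<delta> :: real
  assumes \<delta>: "\<delta> > 0" "\<delta> \<le> 1"
  shows "(\<Sum>k<N. real (Suc k) powr (- 1 - \<delta>)) \<le> 2 / \<delta>"
proof (cases N)
  case (Suc M)
  have "\<delta> * (\<Sum>k<M. real (Suc (Suc k)) powr (- 1 - \<delta>))
      \<le> (\<Sum>k<M. real (Suc k) powr (- \<delta>) - real (Suc (Suc k)) powr (- \<delta>))"
    unfolding sum_distrib_left
    using powr_diff_bounds(1)[of "real (Suc _)", OF _ \<delta>(1)] by (intro sum_mono) (simp add: add.commute)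
  also have "\<dots> \<le> 1" by (subst sum_lessThan_telescope') simp
  finally have "(\<Sum>k<M. real (Suc (Suc k)) powr (- 1 - \<delta>)) \<le> 1 / \<delta>"
    using \<delta> by (simp add: field_simps)
  \<comment> \<open>The term for the integer 1 lies outside the telescoping sum; \<delta> \<le> 1
    absorbs it.\<close>
  moreover have "1 + 1 / \<delta> \<le> 2 / \<delta>" using \<delta> by (simp add: field_simps)
  ultimately show ?thesis unfolding Suc by (simp add: sum.lessThan_Suc_shift del: sum.lessThan_Suc)
qed (use \<delta> in simp)

section \<open>L-series and Euler products for real s > 1\<close>

context dirichlet_character
begin

text \<open>The term for \<open>k = 0\<close> vanishes because \<open>0 powr x = 0\<close>.\<close>

definition term_L :: "real \<Rightarrow> nat \<Rightarrow> complex" where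
  "term_L s k = (real k powr (- s)) *\<^sub>R \<psi> k"

text \<open>An unordered sum, to match sieving over sets. It serves only for s > 1, where the terms
  are absolutely summable; the value at 1 is the ordered series \<open>L1\<close>.\<close>

definition L :: "real \<Rightarrow> complex" where
  "L s = infsum (term_L s) UNIV"

lemma term_L_mult: "term_L s (j * k) = term_L s j * term_L s k"
  by (simp add: term_L_def mult powr_mult)

lemma term_L_1: "term_L s 1 = 1"
  using one by (simp add: term_L_def)

lemma abs_summable_term_L:
  assumes "s > 1"
  shows "(\<lambda>k. norm (term_L s k)) summable_on UNIV"
proof -
  have "summable (\<lambda>k. real k powr (- s))" using assms by (simp add: summable_real_powr_iff)
  then have "summable (\<lambda>k. norm (term_L s k))"
    by (rule summable_comparison_test[rotated])
      (use norm_le_1 in \<open>auto simp: term_L_def mult_left_le intro!: exI[of _ 0]\<close>)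
  then show ?thesis by (subst summable_on_UNIV_nonneg_real_iff) auto
qed

lemma L_sums:
  assumes "s > 1"
  shows "(\<lambda>k. (real (Suc k) powr (- s)) *\<^sub>R \<psi> (Suc k)) sums L s"
proof -
  have "term_L s sums L s"
    unfolding L_def
    by (rule has_sum_imp_sums[OF has_sum_infsum[OF abs_summable_summable[OF abs_summable_term_L[OF assms]]]])
  then have "(\<lambda>k. term_L s (Suc k)) sums (L s - term_L s 0)" by (simp add: sums_Suc_iff)
  then show ?thesis by (simp add: term_L_def)
qed

lemma euler_product:
  assumes "s > 1"
  shows "(\<lambda>N. (\<Prod>p | prime p \<and> p < N. 1 - term_L s p) * L s) \<longlonglongrightarrow> 1"
  unfolding L_def
  by (rule euler_product_tendsto[OF term_L_mult term_L_1 abs_summable_term_L[OF assms]])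

text \<open>A pole at 1 is at most simple. The bound is meant for the principal character.\<close>

lemma norm_L_le:
  assumes \<delta>: "\<delta> > 0" "\<delta> \<le> 1"
  shows "norm (L (1 + \<delta>)) \<le> 2 / \<delta>"
proof -
  have "(\<lambda>N. \<Sum>k<N. (real (Suc k) powr (- (1 + \<delta>))) *\<^sub>R \<psi> (Suc k)) \<longlonglongrightarrow> L (1 + \<delta>)"
    using L_sums[of "1 + \<delta>"] \<delta> by (simp add: sums_def)
  moreover have "norm (\<Sum>k<N. (real (Suc k) powr (- (1 + \<delta>))) *\<^sub>R \<psi> (Suc k)) \<le> 2 / \<delta>" for N
  proof -
    have "norm (\<Sum>k<N. (real (Suc k) powr (- (1 + \<delta>))) *\<^sub>R \<psi> (Suc k))
        \<le> (\<Sum>k<N. real (Suc k) powr (- 1 - \<delta>))"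
      by (intro sum_norm_le) (use norm_le_1 in \<open>auto simp: mult_left_le\<close>)
    also note sum_powr_le[OF \<delta>]
    finally show ?thesis .
  qed
  ultimately show ?thesis by (intro Lim_norm_ubound[OF sequentially_bot]) auto
qed

lemma principal_character: "dirichlet_character n (\<lambda>k. of_bool (coprime k n))"
proof
  show "of_bool (coprime (k + n) n) = (of_bool (coprime k n) :: complex)" for k
    by (simp add: coprime_iff_gcd_eq_1)
qed (use modulus_pos in auto)

lemma square_character: "dirichlet_character n (\<lambda>k. \<psi> k ^ 2)"
proof
  show "\<psi> (k + n) ^ 2 = \<psi> k ^ 2" for k by (simp add: periodic)
  show "\<psi> k ^ 2 = 0" if "\<not> coprime k n" for k using zero[OF that] by simp
qed (use modulus_pos one mult in \<open>auto simp: power_mult_distrib\<close>)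

end

section \<open>Behaviour near s = 1 for nonprincipal characters\<close>

context nonprincipal_character
begin

lemma norm_L_le_modulus:
  assumes "s > 1"
  shows "norm (L s) \<le> n"
proof -
  have w: "decseq (\<lambda>k. real (Suc k) powr (- s))" "(\<lambda>k. real (Suc k) powr (- s)) \<longlonglongrightarrow> 0"
  proof -
    show "decseq (\<lambda>k. real (Suc k) powr (- s))"
      using assms by (intro decseq_SucI powr_mono2') auto
    show "(\<lambda>k. real (Suc k) powr (- s)) \<longlonglongrightarrow> 0"
      using assms by (intro LIMSEQ_Suc tendsto_neg_powr filterlim_real_sequentially) auto
  qed
  show ?thesis
    using norm_suminf_scaleR_decseq_le(1)[OF norm_sum_le w] L_sums[OF assms] by (simp add: sums_iff)
qed

text \<open>An elementary substitute for differentiability at 1. Summation by parts is applied to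
  the terms of \<open>L1\<close> with weights k^(-\<delta>). Since the whole series vanishes, its
  partial sums are minus its tails and of size O(1/k); the weights change by at most \<delta>/k, so
  the products sum to O(\<delta>).\<close>

lemma norm_L_le_if_L1_eq_0:
  assumes L1: "L1 = 0"
  obtains C where "C > 0" "\<And>\<delta>. 0 < \<delta> \<Longrightarrow> norm (L (1 + \<delta>)) \<le> C * \<delta>"
proof -
  define c where "c = (\<lambda>k. (1 / real (Suc k)) *\<^sub>R \<psi> (Suc k))"
  have c_partial: "norm (\<Sum>k<N. c k) \<le> 2 * real n / real (Suc N)" for N
  proof -
    have "(\<Sum>k<N. c k) = - (\<Sum>k. c (k + N))"
      using suminf_split_initial_segment[OF summable_L1, of N] L1 by (simp add: L1_def c_def algebra_simps eq_neg_iff_add_eq_0)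
    moreover have "norm (\<Sum>k. c (k + N)) \<le> 2 * real n * (1 / real (Suc N))"
      using norm_suminf_scaleR_decseq_le(2)[OF norm_sum_le, of "\<lambda>k. 1 / real (Suc k)" N] LIMSEQ_Suc[OF lim_1_over_n]
      by (simp add: c_def decseq_def frac_le)
    ultimately show ?thesis by simp
  qed
  define Z where "Z = (\<Sum>k. 1 / (real (Suc k))\<^sup>2)"
  have Zs: "summable (\<lambda>k. 1 / (real (Suc k))\<^sup>2)"
    using inverse_power_summable[of 2, where 'a = real] by (subst summable_Suc_iff) (simp add: divide_inverse)
  \<comment> \<open>The summand 1 merely makes the constant positive.\<close>
  have bound: "norm (L (1 + \<delta>)) \<le> (2 * real n * Z + 1) * \<delta>" if \<delta>: "\<delta> > 0" for \<delta>
  proof -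
    define w where "w = (\<lambda>k. real (Suc k) powr (- \<delta>))"
    have w1: "0 \<le> w k" "w k \<le> 1" for k
      using \<delta> by (auto simp: w_def powr_minus ge_one_powr_ge_zero inverse_le_1_iff)
    have wd: "0 \<le> w k - w (Suc k)" "w k - w (Suc k) \<le> \<delta> / real (Suc k)" for k
    proof -
      show "0 \<le> w k - w (Suc k)" using \<delta> by (simp add: w_def powr_mono2')
      show "w k - w (Suc k) \<le> \<delta> / real (Suc k)"
        using powr_diff_bounds(2)[of "real (Suc k)" \<delta>] \<delta> by (simp add: w_def add.commute)
    qed
    have wc: "(real (Suc k) powr (- (1 + \<delta>))) *\<^sub>R \<psi> (Suc k) = w k *\<^sub>R c k" for k
    proof -
      have "real (Suc k) powr (- (1 + \<delta>)) = w k * (1 / real (Suc k))"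
        by (simp add: w_def powr_diff powr_minus_divide)
      then show ?thesis by (simp add: c_def)
    qed
    have "(\<lambda>N. \<Sum>k<N. w k *\<^sub>R c k) \<longlonglongrightarrow> L (1 + \<delta>)"
      using L_sums[of "1 + \<delta>"] \<delta> unfolding wc by (simp add: sums_def)
    from tendsto_norm[OF this] have lim1: "(\<lambda>N. norm (\<Sum>k<N. w k *\<^sub>R c k)) \<longlonglongrightarrow> norm (L (1 + \<delta>))" .
    have "(\<lambda>N. 2 * real n * (1 / real (Suc N)) + 2 * real n * Z * \<delta>) \<longlonglongrightarrow> 2 * real n * 0 + 2 * real n * Z * \<delta>"
      using LIMSEQ_Suc[OF lim_1_over_n] by (intro tendsto_intros)
    then have lim2: "(\<lambda>N. 2 * real n / real (Suc N) + 2 * real n * Z * \<delta>) \<longlonglongrightarrow> 2 * real n * Z * \<delta>" by simp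
    have "norm (\<Sum>k<N. w k *\<^sub>R c k) \<le> 2 * real n / real (Suc N) + 2 * real n * Z * \<delta>" for N
    proof -
      have "norm (\<Sum>k<N. w k *\<^sub>R c k) \<le> norm (w N *\<^sub>R (\<Sum>k<N. c k)) +
          (\<Sum>k<N. norm ((w k - w (Suc k)) *\<^sub>R (\<Sum>j<Suc k. c j)))"
        unfolding sum_scaleR_by_parts[of w c N]
        by (intro order.trans[OF norm_triangle_ineq] add_left_mono norm_sum)
      also have "\<dots> \<le> 1 * (2 * real n / real (Suc N)) + (\<Sum>k<N. \<delta> / real (Suc k) * (2 * real n / real (Suc k)))"
      proof (intro add_mono sum_mono)
        show "norm (w N *\<^sub>R (\<Sum>k<N. c k)) \<le> 1 * (2 * real n / real (Suc N))"
          using w1[of N] c_partial[of N] unfolding norm_scaleR by (intro mult_mono) auto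
        show "norm ((w k - w (Suc k)) *\<^sub>R (\<Sum>j<Suc k. c j)) \<le> \<delta> / real (Suc k) * (2 * real n / real (Suc k))" for k
        proof -
          have "2 * real n / real (Suc (Suc k)) \<le> 2 * real n / real (Suc k)" by (intro divide_left_mono) auto
          then have "norm (\<Sum>j<Suc k. c j) \<le> 2 * real n / real (Suc k)" using c_partial[of "Suc k"] by linarith
          then show ?thesis using wd[of k] \<delta> unfolding norm_scaleR by (intro mult_mono) auto
        qed
      qed
      also have "(\<Sum>k<N. \<delta> / real (Suc k) * (2 * real n / real (Suc k))) = 2 * real n * \<delta> * (\<Sum>k<N. 1 / (real (Suc k))\<^sup>2)"
        by (simp add: sum_distrib_left power2_eq_square mult_ac)
      also have "\<dots> \<le> 2 * real n * \<delta> * Z"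
        unfolding Z_def using \<delta> by (intro mult_left_mono sum_le_suminf[OF Zs]) auto
      finally show ?thesis by (simp add: mult_ac)
    qed
    then have "norm (L (1 + \<delta>)) \<le> 2 * real n * Z * \<delta>"
      by (intro tendsto_le[OF sequentially_bot lim2 lim1]) auto
    then show ?thesis using \<delta> by (simp add: algebra_simps)
  qed
  have "Z \<ge> 0" unfolding Z_def by (intro suminf_nonneg[OF Zs]) auto
  then show ?thesis using that[of "2 * real n * Z + 1"] bound by (simp add: add_nonneg_pos)
qed

text \<open>The inequality $3 + 4\cos\theta + \cos 2\theta \ge 0$ bounds the product of the Euler
  factors of $L(s,1)^3 L(s,\psi)^4 L(s,\psi^2)$ uniformly in $s > 1$.\<close>

lemma L_341_bounded_below:
  obtains c where "c > 0"
    "\<And>s. s > 1 \<Longrightarrow> c \<le> norm (dirichlet_character.L (\<lambda>k. of_bool (coprime k n)) s) ^ 3 *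
        norm (L s) ^ 4 * norm (dirichlet_character.L (\<lambda>k. \<psi> k ^ 2) s)"
proof -
  interpret p: dirichlet_character n "\<lambda>k. of_bool (coprime k n)" by (rule principal_character)
  interpret q: dirichlet_character n "\<lambda>k. \<psi> k ^ 2" by (rule square_character)
  define Z where "Z = (\<Sum>k. 1 / (real k)\<^sup>2)"
  have Zs: "summable (\<lambda>k. 1 / (real k)\<^sup>2)"
    using inverse_power_summable[of 2, where 'a = real] by (simp add: divide_inverse)
  \<comment> \<open>The number 8 = 3 + 4 + 1 counts the quadratic errors, while the first-order
    terms combine to a nonpositive exponent. Since norms are squared here, 8 becomes 4 once the root
    is taken.\<close>
  have factor: "(norm ((1 - p.term_L s k) ^ 3 * (1 - term_L s k) ^ 4 * (1 - q.term_L s k)))\<^sup>2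
      \<le> exp (8 * (1 / (real k)\<^sup>2))" if s: "s > 1" and k: "k > 0" for s k
  proof (cases "coprime k n")
    case True
    define x where "x = real k powr (- s)"
    define z where "z = \<psi> k"
    have z: "norm z = 1" using norm_eq_1[OF True] by (simp add: z_def)
    have eqs: "p.term_L s k = of_real x * 1" "term_L s k = of_real x * z" "q.term_L s k = of_real x * z\<^sup>2"
      using True by (simp_all add: p.term_L_def term_L_def q.term_L_def x_def z_def scaleR_conv_of_real)
    have x0: "x \<ge> 0" by (simp add: x_def)
    have "x \<le> real k powr (- 1)" unfolding x_def using s k by (intro powr_mono) auto
    then have "x\<^sup>2 \<le> (1 / real k)\<^sup>2" using x0 k by (intro power_mono) (auto simp: powr_minus_divide)
    then have x: "x\<^sup>2 \<le> 1 / (real k)\<^sup>2" by (simp add: power_divide)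
    have "(Re z)\<^sup>2 + (Im z)\<^sup>2 = 1" using z by (simp flip: cmod_power2)
    then have "Re (z\<^sup>2) = 2 * (Re z)\<^sup>2 - 1" by (simp add: power2_eq_square)
    then have "3 + 4 * Re z + Re (z\<^sup>2) = 2 * (1 + Re z)\<^sup>2" by (simp add: power2_eq_square algebra_simps)
    then have pos: "0 \<le> x * (3 + 4 * Re z + Re (z\<^sup>2))" using x0 by simp
    have "(norm ((1 - p.term_L s k) ^ 3 * (1 - term_L s k) ^ 4 * (1 - q.term_L s k)))\<^sup>2 =
       ((norm (1 - complex_of_real x * 1))\<^sup>2) ^ 3 * ((norm (1 - complex_of_real x * z))\<^sup>2) ^ 4 * (norm (1 - complex_of_real x * z\<^sup>2))\<^sup>2"
      unfolding eqs by (simp add: norm_mult norm_power power_mult_distrib flip: power_mult)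
    also have "\<dots> \<le> exp (x\<^sup>2 - 2 * x * Re 1) ^ 3 * exp (x\<^sup>2 - 2 * x * Re z) ^ 4 * exp (x\<^sup>2 - 2 * x * Re (z\<^sup>2))"
      using z by (intro mult_mono power_mono norm_euler_factor_le) (auto simp: norm_power)
    also have "\<dots> = exp (8 * x\<^sup>2 - 2 * (x * (3 + 4 * Re z + Re (z\<^sup>2))))"
      by (simp add: algebra_simps flip: exp_add exp_of_nat_mult)
    also have "\<dots> \<le> exp (8 * (1 / (real k)\<^sup>2))" using pos x by simp
    finally show ?thesis .
  next
    case False
    then show ?thesis using zero[of k] by (simp add: p.term_L_def term_L_def q.term_L_def)
  qed
  have "exp (- (4 * Z)) \<le> norm (p.L s) ^ 3 * norm (L s) ^ 4 * norm (q.L s)" if s: "s > 1" for s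
  proof -
    define Q where "Q = (\<lambda>N. \<Prod>p | prime p \<and> p < N. (1 - p.term_L s p) ^ 3 * (1 - term_L s p) ^ 4 * (1 - q.term_L s p))"
    have "(\<lambda>N. ((\<Prod>p | prime p \<and> p < N. 1 - p.term_L s p) * p.L s) ^ 3 *
        ((\<Prod>p | prime p \<and> p < N. 1 - term_L s p) * L s) ^ 4 *
        ((\<Prod>p | prime p \<and> p < N. 1 - q.term_L s p) * q.L s)) \<longlonglongrightarrow> 1 ^ 3 * 1 ^ 4 * 1"
      by (intro tendsto_mult tendsto_power p.euler_product euler_product q.euler_product s)
    then have "(\<lambda>N. Q N * (p.L s ^ 3 * L s ^ 4 * q.L s)) \<longlonglongrightarrow> 1"
      by (simp add: Q_def prod.distrib prod_power_distrib power_mult_distrib mult_ac)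
    from tendsto_norm[OF this]
    have lim: "(\<lambda>N. norm (Q N) * norm (p.L s ^ 3 * L s ^ 4 * q.L s)) \<longlonglongrightarrow> 1" by (simp add: norm_mult)
    have "norm (Q N) \<le> exp (4 * Z)" for N
    proof -
      have "(norm (Q N))\<^sup>2 = (\<Prod>p | prime p \<and> p < N. (norm ((1 - p.term_L s p) ^ 3 * (1 - term_L s p) ^ 4 * (1 - q.term_L s p)))\<^sup>2)"
        unfolding Q_def prod_norm[symmetric] prod_power_distrib ..
      also have "\<dots> \<le> (\<Prod>p | prime p \<and> p < N. exp (8 * (1 / (real p)\<^sup>2)))"
        by (intro prod_mono) (use factor[OF s] prime_gt_0_nat in auto)
      also have "\<dots> = exp (8 * (\<Sum>p | prime p \<and> p < N. 1 / (real p)\<^sup>2))"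
        by (simp add: exp_sum sum_distrib_left)
      also have "\<dots> \<le> exp (8 * Z)"
        unfolding Z_def by (simp, intro sum_le_suminf[OF Zs]) auto
      also have "\<dots> = (exp (4 * Z))\<^sup>2" by (simp add: power2_eq_square flip: exp_add)
      finally show ?thesis by (rule power2_le_imp_le) simp
    qed
    then have "1 \<le> exp (4 * Z) * norm (p.L s ^ 3 * L s ^ 4 * q.L s)"
      by (intro tendsto_upperbound[OF lim]) (auto intro!: always_eventually mult_right_mono)
    then show ?thesis by (simp add: exp_minus field_simps norm_mult norm_power)
  qed
  then show ?thesis using that[of "exp (- (4 * Z))"] by simp
qed

text \<open>With a zero at 1, the three factors at s = 1 + \<delta> are of order \<delta>^(-3),
  \<delta>^4 and 1, the last because the square is nonprincipal. Their product tends to 0, against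
  the lower bound.\<close>

lemma L1_nonzero_if_square_nonprincipal:
  assumes sq: "\<exists>k. coprime k n \<and> \<psi> k ^ 2 \<noteq> 1"
  shows "L1 \<noteq> 0"
proof
  assume "L1 = 0"
  then obtain C where C: "C > 0" "\<And>\<delta>. 0 < \<delta> \<Longrightarrow> norm (L (1 + \<delta>)) \<le> C * \<delta>"
    using norm_L_le_if_L1_eq_0 by blast
  interpret p: dirichlet_character n "\<lambda>k. of_bool (coprime k n)" by (rule principal_character)
  interpret q: dirichlet_character n "\<lambda>k. \<psi> k ^ 2" by (rule square_character)
  interpret q: nonprincipal_character n "\<lambda>k. \<psi> k ^ 2" by unfold_locales (rule sq)
  obtain c where c: "c > 0" "\<And>s. s > 1 \<Longrightarrow> c \<le> norm (p.L s) ^ 3 * norm (L s) ^ 4 * norm (q.L s)"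
    using L_341_bounded_below by blast
  have bound: "c \<le> 8 * C ^ 4 * n * \<delta>" if \<delta>: "0 < \<delta>" "\<delta> \<le> 1" for \<delta>
  proof -
    have "c \<le> norm (p.L (1 + \<delta>)) ^ 3 * norm (L (1 + \<delta>)) ^ 4 * norm (q.L (1 + \<delta>))"
      using c(2) \<delta> by simp
    also have "\<dots> \<le> (2 / \<delta>) ^ 3 * (C * \<delta>) ^ 4 * n"
      using p.norm_L_le[OF \<delta>] C \<delta> q.norm_L_le_modulus[of "1 + \<delta>"]
      by (intro mult_mono power_mono) auto
    also have "\<dots> = 8 * C ^ 4 * n * \<delta>"
      using \<delta> by (simp add: field_simps power_numeral_reduce)
    finally show ?thesis .
  qed
  define K where "K = 8 * C ^ 4 * n"
  have K: "K > 0" using C(1) modulus_pos by (simp add: K_def)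
  have "c \<le> K * min 1 (c / (2 * K))" using bound[of "min 1 (c / (2 * K))"] K c(1) by (simp add: K_def)
  also have "\<dots> \<le> K * (c / (2 * K))" using K by (intro mult_left_mono) auto
  also have "\<dots> < c" using K c(1) by simp
  finally show False by simp
qed

theorem L1_nonzero: "L1 \<noteq> 0"
proof (cases "\<exists>k. coprime k n \<and> \<psi> k ^ 2 \<noteq> 1")
  case True
  then show ?thesis by (rule L1_nonzero_if_square_nonprincipal)
next
  case False
  have "\<psi> k \<in> \<real>" for k
  proof (cases "coprime k n")
    case True
    then have "\<psi> k ^ 2 = 1" using False by blast
    then show ?thesis by (auto simp: power2_eq_1_iff)
  qed (simp add: zero)
  then show ?thesis by (rule L1_nonzero_if_real)
qed

end

section \<open>From sawtooth sums to L(1)\<close>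

context nonprincipal_character
begin

text \<open>Abel's theorem. The weights decrease in k and are at most 1/(k+1) for every r in [0,1],
  so the tail estimate is uniform in r and the sum is continuous up to r = 1.\<close>

lemma L1_abel_limit:
  "((\<lambda>r. \<Sum>k. (r ^ Suc k / real (Suc k)) *\<^sub>R \<psi> (Suc k)) \<longlongrightarrow> L1) (at_left 1)"
proof -
  define w where "w = (\<lambda>r k. r ^ Suc k / real (Suc k))"
  define F where "F = (\<lambda>r. \<Sum>k. w r k *\<^sub>R \<psi> (Suc k))"
  have w: "decseq (w r)" "w r \<longlonglongrightarrow> 0" "w r k \<le> 1 / real (Suc k)" if r: "r \<in> {0..1}" for r k
  proof -
    show "decseq (w r)"
      unfolding w_def using r by (intro decseq_SucI frac_le power_decreasing) auto
    show *: "w r k \<le> 1 / real (Suc k)" for k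
      unfolding w_def using r by (intro divide_right_mono power_le_one) auto
    have nonneg: "0 \<le> w r k" for k unfolding w_def using r by simp
    show "w r \<longlonglongrightarrow> 0"
      by (rule tendsto_sandwich[OF _ _ tendsto_const LIMSEQ_Suc[OF lim_1_over_n]])
        (use * nonneg in auto)
  qed
  have "uniform_limit {0..1} (\<lambda>m r. \<Sum>k<m. w r k *\<^sub>R \<psi> (Suc k)) F sequentially"
  proof (rule uniform_limitI)
    fix e :: real assume e: "e > 0"
    have "(\<lambda>m. 2 * real n * (1 / real (Suc m))) \<longlonglongrightarrow> 2 * real n * 0"
      using LIMSEQ_Suc[OF lim_1_over_n] by (intro tendsto_intros)
    then have "\<forall>\<^sub>F m in sequentially. 2 * real n * (1 / real (Suc m)) < e"
      using e by (intro order_tendstoD) auto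
    then show "\<forall>\<^sub>F m in sequentially. \<forall>r\<in>{0..1}. dist (\<Sum>k<m. w r k *\<^sub>R \<psi> (Suc k)) (F r) < e"
    proof (rule eventually_mono, intro ballI)
      fix m r assume m: "2 * real n * (1 / real (Suc m)) < e" and r: "r \<in> {0..1::real}"
      have "F r = (\<Sum>k. w r (k + m) *\<^sub>R \<psi> (Suc (k + m))) + (\<Sum>k<m. w r k *\<^sub>R \<psi> (Suc k))"
        unfolding F_def
        using suminf_split_initial_segment[OF summable_scaleR_decseq[OF norm_sum_le w(1,2)[OF r]], of m] .
      then have "dist (\<Sum>k<m. w r k *\<^sub>R \<psi> (Suc k)) (F r) = norm (\<Sum>k. w r (k + m) *\<^sub>R \<psi> (Suc (k + m)))"
        by (simp add: dist_norm)
      also have "\<dots> \<le> 2 * real n * w r m"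
        using norm_suminf_scaleR_decseq_le(2)[OF norm_sum_le w(1,2)[OF r], of m] .
      also have "\<dots> \<le> 2 * real n * (1 / real (Suc m))" by (intro mult_left_mono w(3)[OF r]) auto
      finally show "dist (\<Sum>k<m. w r k *\<^sub>R \<psi> (Suc k)) (F r) < e" using m by simp
    qed
  qed
  then have "continuous_on {0..1} F"
    by (rule uniform_limit_theorem[rotated])
      (auto simp: w_def intro!: always_eventually continuous_intros)
  then have "(F \<longlongrightarrow> F 1) (at 1 within {0..1})" by (simp add: continuous_on)
  moreover have "F 1 = L1" by (simp add: F_def w_def L1_def)
  ultimately show ?thesis by (simp add: F_def w_def at_within_Icc_at_left)
qed

end

section \<open>Fourier series of the sawtooth via the complex logarithm\<close>

lemma sin_series_sums:
  fixes r \<theta> :: real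
  assumes r: "0 \<le> r" "r < 1"
  shows "(\<lambda>k. r ^ Suc k / real (Suc k) * sin (real (Suc k) * \<theta>)) sums
    (- Im (Ln (1 - of_real r * cis \<theta>)))"
proof -
  have "norm (- (of_real r * cis \<theta>)) < 1" using r by (simp add: norm_mult)
  from sums_minus[OF sums_Im[OF Ln_series'[OF this]]]
  have "(\<lambda>k. Im ((of_real r * cis \<theta>) ^ k / of_nat k)) sums (- Im (Ln (1 - of_real r * cis \<theta>)))"
    by simp
  moreover have "Im ((of_real r * cis \<theta>) ^ k / of_nat k) = r ^ k / real k * sin (real k * \<theta>)" for k
    by (simp add: power_mult_distrib Complex.DeMoivre Im_divide_of_nat flip: of_real_power)
  ultimately have "(\<lambda>k. r ^ k / real k * sin (real k * \<theta>)) sums (- Im (Ln (1 - of_real r * cis \<theta>)))"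
    by (simp only:)
  then show ?thesis by (subst sums_Suc_iff) simp
qed

text \<open>For 0 < \<phi> < 2 pi one has 1 - exp(i \<phi>) = 2 sin(\<phi>/2) exp(i (\<phi> - pi)/2)
  with an argument in (-pi/2, pi/2). This is therefore the principal one, and the logarithm is
  continuous there.\<close>

lemma sawtooth_abel_limit:
  fixes x :: real
  assumes x: "x \<notin> \<int>"
  shows "((\<lambda>r. - Im (Ln (1 - of_real r * cis (2 * pi * x)))) \<longlongrightarrow> pi * (1 / 2 - frac x)) (at_left 1)"
proof -
  define \<phi> where "\<phi> = 2 * pi * frac x"
  have fx: "0 < frac x" "frac x < 1" using x by (simp_all add: frac_lt_1)
  have "2 * pi * x = \<phi> + 2 * pi * of_int \<lfloor>x\<rfloor>" by (simp add: \<phi>_def frac_def algebra_simps)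
  then have cis: "cis (2 * pi * x) = cis \<phi>"
    by (simp add: cis_mult[symmetric] cis_multiple_2pi)
  have \<phi>: "0 < \<phi>" "\<phi> < 2 * pi" using fx by (simp_all add: \<phi>_def)
  have spos: "0 < sin (\<phi> / 2)" using \<phi> by (intro sin_gt_zero) auto
  define \<alpha> where "\<alpha> = (\<phi> - pi) / 2"
  have "1 - cis \<phi> = of_real (2 * sin (\<phi> / 2)) * cis \<alpha>"
  proof (rule complex_eqI)
    have a: "cos \<alpha> = sin (\<phi> / 2)" "sin \<alpha> = - cos (\<phi> / 2)"
      by (simp_all add: \<alpha>_def diff_divide_distrib cos_diff sin_diff)
    have b: "cos \<phi> = 1 - 2 * (sin (\<phi> / 2))\<^sup>2" "sin \<phi> = 2 * sin (\<phi> / 2) * cos (\<phi> / 2)"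
      using cos_double_sin[of "\<phi> / 2"] sin_double[of "\<phi> / 2"] by simp_all
    show "Re (1 - cis \<phi>) = Re (of_real (2 * sin (\<phi> / 2)) * cis \<alpha>)"
      by (simp add: a b power2_eq_square)
    show "Im (1 - cis \<phi>) = Im (of_real (2 * sin (\<phi> / 2)) * cis \<alpha>)"
      by (simp add: a b)
  qed
  also have "\<dots> = exp (Complex (ln (2 * sin (\<phi> / 2))) \<alpha>)"
    using spos by (simp add: exp_eq_polar)
  finally have eq: "1 - cis \<phi> = exp (Complex (ln (2 * sin (\<phi> / 2))) \<alpha>)" .
  have "Ln (1 - cis \<phi>) = Complex (ln (2 * sin (\<phi> / 2))) \<alpha>"
    unfolding eq using \<phi> by (intro Ln_exp) (auto simp: \<alpha>_def)
  then have val: "- Im (Ln (1 - of_real 1 * cis \<phi>)) = pi * (1 / 2 - frac x)"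
    by (simp add: \<alpha>_def \<phi>_def field_simps)
  have "cos \<phi> < 1"
    using cos_double_sin[of "\<phi> / 2"] spos by simp
  then have "1 - of_real 1 * cis \<phi> \<notin> \<real>\<^sub>\<le>\<^sub>0"
    by (auto simp: complex_nonpos_Reals_iff)
  then have "((\<lambda>r. - Im (Ln (1 - of_real r * cis \<phi>))) \<longlongrightarrow> - Im (Ln (1 - of_real 1 * cis \<phi>))) (at_left 1)"
    by (intro tendsto_intros)
  then show ?thesis unfolding val cis .
qed

section \<open>Orthogonality relations modulo n\<close>

lemma sum_cis_residues:
  assumes "n > 0"
  shows "(\<Sum>t<n. cis (2 * pi * real t * real_of_int j / real n)) = (if int n dvd j then of_nat n else 0)"
proof -
  define \<omega> where "\<omega> = cis (2 * pi * real_of_int j / real n)"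
  have pow: "\<omega> ^ t = cis (2 * pi * real t * real_of_int j / real n)" for t
    by (simp add: \<omega>_def Complex.DeMoivre mult_ac)
  have one_iff: "\<omega> = 1 \<longleftrightarrow> int n dvd j"
  proof
    assume "\<omega> = 1"
    then have "cos (2 * pi * real_of_int j / real n) = 1" by (simp add: \<omega>_def complex_eq_iff)
    then obtain m :: int where "2 * pi * real_of_int j / real n = real_of_int m * 2 * pi"
      by (auto simp: cos_one_2pi_int)
    then have "real_of_int j = real_of_int (m * int n)" using assms by (simp add: field_simps)
    then have "j = m * int n" by (simp only: of_int_eq_iff)
    then show "int n dvd j" by simp
  next
    assume "int n dvd j"
    then obtain m where "j = int n * m" by auto
    then show "\<omega> = 1" using assms cis_multiple_2pi[of "of_int m"] by (simp add: \<omega>_def mult_ac)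
  qed
  have pn: "\<omega> ^ n = 1"
    unfolding pow using assms cis_multiple_2pi[of "of_int j"] by (simp add: mult_ac)
  have "(\<Sum>t<n. \<omega> ^ t) = (if int n dvd j then of_nat n else 0)"
    using one_iff pn by (auto simp: sum_gp_strict)
  then show ?thesis by (simp only: pow)
qed

lemma sum_cos_residues:
  assumes "n > 0"
  shows "(\<Sum>t<n. cos (2 * pi * real t * real_of_int j / real n)) = (if int n dvd j then real n else 0)"
  using arg_cong[OF sum_cis_residues[OF assms, of j], of Re] by simp

lemma sum_sin_sin_residues:
  assumes "n > 0"
  shows "(\<Sum>t<n. sin (2 * pi * real t / real n) * sin (2 * pi * real t * real m / real n)) =
    real n / 2 * (of_bool ([m = 1] (mod n)) - of_bool (n dvd m + 1))"
proof -
  have "sin (2 * pi * real t / real n) * sin (2 * pi * real t * real m / real n) =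
      cos (2 * pi * real t * real_of_int (int m - 1) / real n) / 2 -
      cos (2 * pi * real t * real_of_int (int m + 1) / real n) / 2" for t
    using sin_times_sin[of "2 * pi * real t * real m / real n" "2 * pi * real t / real n"]
    by (simp add: diff_divide_distrib algebra_simps add_divide_distrib)
  moreover have "int n dvd int m - 1 \<longleftrightarrow> [m = 1] (mod n)"
    by (metis cong_iff_dvd_diff cong_int_iff of_nat_1)
  moreover have "int n dvd int m + 1 \<longleftrightarrow> n dvd m + 1"
    by (metis int_dvd_int_iff of_nat_1 of_nat_add)
  ultimately show ?thesis
    using sum_cos_residues[OF assms, of "int m - 1"] sum_cos_residues[OF assms, of "int m + 1"]
    by (simp add: sum_subtractf flip: sum_divide_distrib)
qed

text \<open>A double sum over t and a of the damped sine series is evaluated twice. Termwise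
  summation gives n times the damped series of L(1) for the conjugate character; r tending to 1
  inside the finite sum gives pi times a combination of the sawtooth sums, all of which vanish, the
  sine weight removing t = 0.\<close>

lemma (in dirichlet_character) odd_character_sawtooth_sum_nonzero:
  assumes odd: "\<psi> (n - 1) = -1"
    and vanish: "\<And>t. t \<in> {1..<n} \<Longrightarrow> (\<Sum>a<n. \<psi> a * of_real (1 / 2 - frac (real t * real a / real n))) = 0"
  shows False
proof -
  interpret c: nonprincipal_character n "\<lambda>k. cnj (\<psi> k)"
  proof
    show "cnj (\<psi> (k + n)) = cnj (\<psi> k)" for k by (simp add: periodic)
    show "cnj (\<psi> k) = 0" if "\<not> coprime k n" for k using zero[OF that] by simp
    show "\<exists>k. coprime k n \<and> cnj (\<psi> k) \<noteq> 1"
      using odd zero[of "n - 1"] by (intro exI[of _ "n - 1"]) auto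
  qed (use modulus_pos one mult in auto)
  \<comment> \<open>If k is a unit, the solutions of k a = 1 and k a = -1 contribute the conjugate
    of \<open>\<psi> k\<close> with opposite signs, and their difference cancels the factor 1/2.
    Otherwise neither congruence is solvable.\<close>
  have kernel: "(\<Sum>t<n. \<Sum>a<n. of_real (sin (2 * pi * real t / real n)) * \<psi> a *
      of_real (sin (2 * pi * real t * real (k * a) / real n))) = of_nat n * cnj (\<psi> k)" for k
  proof -
    have ob: "complex_of_real (of_bool b) = of_bool b" for b by (cases b) auto
    have "(\<Sum>t<n. \<Sum>a<n. of_real (sin (2 * pi * real t / real n)) * \<psi> a *
        of_real (sin (2 * pi * real t * real (k * a) / real n))) =
      (\<Sum>a<n. \<psi> a * of_real (\<Sum>t<n. sin (2 * pi * real t / real n) * sin (2 * pi * real t * real (k * a) / real n)))"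
      by (subst sum.swap) (simp add: sum_distrib_left mult_ac)
    also have "\<dots> = of_nat n / 2 * ((\<Sum>a<n. \<psi> a * of_bool ([k * a = 1] (mod n))) -
        (\<Sum>a<n. \<psi> a * of_bool (n dvd k * a + 1)))"
      unfolding sum_sin_sin_residues[OF modulus_pos]
      by (simp add: ob sum_distrib_left sum_subtractf right_diff_distrib mult_ac
          del: sum_mult_of_bool_eq sum_of_bool_mult_eq)
    also have "\<dots> = of_nat n * cnj (\<psi> k)"
    proof (cases "coprime k n")
      case True
      have inv: "\<psi> a = cnj (\<psi> k) * \<psi> c" if "[k * a = c] (mod n)" for a c
      proof -
        have "cnj (\<psi> k) * \<psi> k = 1"
          using norm_eq_1[OF True] complex_norm_square[of "\<psi> k"] by (simp add: mult.commute)
        moreover have "\<psi> k * \<psi> a = \<psi> c" using cong[OF that] mult by simp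
        ultimately show ?thesis by (metis mult.assoc mult_1_left)
      qed
      obtain x where x: "[k * x = 1] (mod n)" using cong_solve_coprime_nat[OF True] by auto
      have solve: "(\<Sum>a<n. \<psi> a * of_bool ([k * a = c] (mod n))) = cnj (\<psi> k) * \<psi> c" for c
      proof -
        define b where "b = x * c mod n"
        have b: "b < n" "[k * b = c] (mod n)"
        proof -
          show "b < n" using modulus_pos by (simp add: b_def)
          have "[k * b = k * (x * c)] (mod n)"
            unfolding b_def by (intro cong_mult cong_refl cong_mod_leftI)
          also have "[k * (x * c) = 1 * c] (mod n)"
            unfolding mult.assoc[symmetric] by (intro cong_mult cong_refl x)
          finally show "[k * b = c] (mod n)" by simp
        qed
        have uniq: "[k * a = c] (mod n) \<longleftrightarrow> a = b" if "a < n" for a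
        proof
          assume "[k * a = c] (mod n)"
          then have "[k * a = k * b] (mod n)" using b(2) cong_sym cong_trans by blast
          then have "[a = b] (mod n)" using True cong_mult_lcancel_nat by blast
          then show "a = b" using that b(1) by (simp add: Cong.cong_def)
        qed (use b in simp)
        have "(\<Sum>a<n. \<psi> a * of_bool ([k * a = c] (mod n))) = (\<Sum>a<n. if a = b then \<psi> b else 0)"
          by (intro sum.cong) (auto simp: uniq)
        also have "\<dots> = cnj (\<psi> k) * \<psi> c" using b inv[of b c] by simp
        finally show ?thesis .
      qed
      have "n dvd k * a + 1 \<longleftrightarrow> [k * a = n - 1] (mod n)" for a
      proof -
        have "[k * a = n - 1] (mod n) \<longleftrightarrow> [k * a + 1 = n - 1 + 1] (mod n)"
          by (rule cong_add_rcancel_nat[symmetric])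
        also have "n - 1 + 1 = n" using modulus_pos by simp
        finally show ?thesis by (simp add: Cong.cong_def dvd_eq_mod_eq_0)
      qed
      then show ?thesis using solve[of 1] solve[of "n - 1"] odd one by simp
    next
      case False
      have "\<not> [k * a = 1] (mod n)" "\<not> n dvd k * a + 1" for a
      proof -
        have "gcd k n \<noteq> 1" using False by (simp add: coprime_iff_gcd_eq_1)
        then obtain p where p: "prime p" "p dvd k" "p dvd n"
          using prime_factor_nat[of "gcd k n"] by auto
        have np: "\<not> p dvd 1" using p(1) by auto
        show "\<not> n dvd k * a + 1"
          using p np by (meson dvd_add_right_iff dvd_mult2 dvd_trans)
        show "\<not> [k * a = 1] (mod n)"
          using p np by (meson cong_dvd_iff cong_dvd_modulus_nat dvd_mult2)
      qed
      then show ?thesis using zero[OF False] by simp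
    qed
    finally show ?thesis .
  qed
  define G where "G = (\<lambda>r x. - Im (Ln (1 - of_real r * cis (2 * pi * x))))"
  have "(\<Sum>t<n. \<Sum>a<n. of_real (sin (2 * pi * real t / real n)) * \<psi> a * of_real (G r (real t * real a / real n)))
      = of_nat n * (\<Sum>k. (r ^ Suc k / real (Suc k)) *\<^sub>R cnj (\<psi> (Suc k)))" if r: "0 \<le> r" "r < 1" for r
  proof -
    have "(\<lambda>k. complex_of_real (r ^ Suc k / real (Suc k) * sin (real (Suc k) * (2 * pi * (real t * real a / real n)))))
        sums of_real (G r (real t * real a / real n))" for t a
      unfolding G_def using sin_series_sums[OF r] by (rule sums_of_real)
    then have "(\<lambda>k. \<Sum>t<n. \<Sum>a<n. of_real (sin (2 * pi * real t / real n)) * \<psi> a *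
          complex_of_real (r ^ Suc k / real (Suc k) * sin (real (Suc k) * (2 * pi * (real t * real a / real n))))) sums
        (\<Sum>t<n. \<Sum>a<n. of_real (sin (2 * pi * real t / real n)) * \<psi> a * of_real (G r (real t * real a / real n)))"
      by (intro sums_sum sums_mult)
    moreover have "(\<Sum>t<n. \<Sum>a<n. of_real (sin (2 * pi * real t / real n)) * \<psi> a *
          complex_of_real (r ^ Suc k / real (Suc k) * sin (real (Suc k) * (2 * pi * (real t * real a / real n))))) =
        of_nat n * ((r ^ Suc k / real (Suc k)) *\<^sub>R cnj (\<psi> (Suc k)))" for k
    proof -
      have "real (Suc k) * (2 * pi * (real t * real a / real n)) = 2 * pi * real t * real (Suc k * a) / real n" for t a
        unfolding of_nat_mult by (simp add: mult_ac)
      then have "(\<Sum>t<n. \<Sum>a<n. of_real (sin (2 * pi * real t / real n)) * \<psi> a *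
          complex_of_real (r ^ Suc k / real (Suc k) * sin (real (Suc k) * (2 * pi * (real t * real a / real n))))) =
        of_real (r ^ Suc k / real (Suc k)) * (\<Sum>t<n. \<Sum>a<n. of_real (sin (2 * pi * real t / real n)) * \<psi> a *
          of_real (sin (2 * pi * real t * real (Suc k * a) / real n)))"
        by (simp only: sum_distrib_left of_real_mult mult_ac)
      then show ?thesis unfolding kernel by (simp only: scaleR_conv_of_real mult_ac)
    qed
    ultimately have sums: "(\<lambda>k. of_nat n * ((r ^ Suc k / real (Suc k)) *\<^sub>R cnj (\<psi> (Suc k)))) sums
        (\<Sum>t<n. \<Sum>a<n. of_real (sin (2 * pi * real t / real n)) * \<psi> a * of_real (G r (real t * real a / real n)))"
      by simp
    have "summable (\<lambda>k. (r ^ Suc k / real (Suc k)) *\<^sub>R cnj (\<psi> (Suc k)))"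
      using modulus_pos sums_summable[OF sums] by (subst (asm) summable_cmult_iff) auto
    from suminf_mult[OF this, of "of_nat n"] sums_unique[OF sums] show ?thesis by (simp only:)
  qed
  then have "\<forall>\<^sub>F r in at_left 1.
      (\<Sum>t<n. \<Sum>a<n. of_real (sin (2 * pi * real t / real n)) * \<psi> a * of_real (G r (real t * real a / real n)))
      = of_nat n * (\<Sum>k. (r ^ Suc k / real (Suc k)) *\<^sub>R cnj (\<psi> (Suc k)))"
    using eventually_at_left_real[of 0 1] by (auto elim!: eventually_mono)
  moreover have "((\<lambda>r. of_nat n * (\<Sum>k. (r ^ Suc k / real (Suc k)) *\<^sub>R cnj (\<psi> (Suc k)))) \<longlongrightarrow> of_nat n * c.L1) (at_left 1)"
    by (intro tendsto_intros c.L1_abel_limit)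
  ultimately have lim1: "((\<lambda>r. \<Sum>t<n. \<Sum>a<n. of_real (sin (2 * pi * real t / real n)) * \<psi> a *
      of_real (G r (real t * real a / real n))) \<longlongrightarrow> of_nat n * c.L1) (at_left 1)"
    by (simp only: tendsto_cong)
  have "((\<lambda>r. \<Sum>t<n. \<Sum>a<n. of_real (sin (2 * pi * real t / real n)) * \<psi> a *
      of_real (G r (real t * real a / real n))) \<longlongrightarrow>
    (\<Sum>t<n. \<Sum>a<n. of_real (sin (2 * pi * real t / real n)) * \<psi> a *
      of_real (pi * (1 / 2 - frac (real t * real a / real n))))) (at_left 1)"
  proof (intro tendsto_sum)
    fix t a assume t: "t \<in> {..<n}"
    show "((\<lambda>r. of_real (sin (2 * pi * real t / real n)) * \<psi> a * of_real (G r (real t * real a / real n))) \<longlongrightarrow>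
        of_real (sin (2 * pi * real t / real n)) * \<psi> a * of_real (pi * (1 / 2 - frac (real t * real a / real n)))) (at_left 1)"
    \<comment> \<open>In these cases the coefficient is 0; in all others t a/n is not an integer, as
      the sawtooth limit requires.\<close>
    proof (cases "t = 0 \<or> \<not> coprime a n")
      case True
      then have "of_real (sin (2 * pi * real t / real n)) * \<psi> a = 0" using zero[of a] by auto
      then show ?thesis by (simp only: mult_zero_left tendsto_const)
    next
      case False
      have "real t * real a / real n \<notin> \<int>"
      proof
        assume "real t * real a / real n \<in> \<int>"
        then obtain m where "real t * real a / real n = of_int m" by (elim Ints_cases)
        then have "real_of_int (int t * int a) = real_of_int (m * int n)"
          using modulus_pos by (simp add: field_simps)
        then have "int (t * a) = m * int n" by (simp only: of_int_eq_iff of_nat_mult)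
        then have "n dvd t * a" by (metis dvd_triv_right int_dvd_int_iff)
        then have "n dvd t" using False by (simp add: coprime_commute coprime_dvd_mult_left_iff)
        then show False using False t by (auto dest: dvd_imp_le)
      qed
      then show ?thesis
        unfolding G_def by (intro tendsto_intros sawtooth_abel_limit)
    qed
  qed
  moreover have "(\<Sum>t<n. \<Sum>a<n. of_real (sin (2 * pi * real t / real n)) * \<psi> a *
      of_real (pi * (1 / 2 - frac (real t * real a / real n)))) = 0"
  proof (rule sum.neutral, rule ballI)
    fix t assume t: "t \<in> {..<n}"
    have "(\<Sum>a<n. of_real (sin (2 * pi * real t / real n)) * \<psi> a * of_real (pi * (1 / 2 - frac (real t * real a / real n))))
      = of_real (sin (2 * pi * real t / real n)) * of_real pi * (\<Sum>a<n. \<psi> a * of_real (1 / 2 - frac (real t * real a / real n)))"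
      by (simp only: sum_distrib_left of_real_mult mult_ac)
    also have "\<dots> = 0" using vanish[of t] t by (cases "t = 0") auto
    finally show "(\<Sum>a<n. of_real (sin (2 * pi * real t / real n)) * \<psi> a * of_real (pi * (1 / 2 - frac (real t * real a / real n)))) = 0" .
  qed
  ultimately have "of_nat n * c.L1 = 0"
    using tendsto_unique[OF _ lim1] by (simp add: trivial_limit_at_left_real)
  then show False using c.L1_nonzero modulus_pos by simp
qed

section \<open>Odd functions on the units\<close>

text \<open>Simultaneous diagonalization of the commuting operators h(x) -> h(u x) by explicit
  projections. By Euler's theorem each has N-th power the identity on V, with N =
  \<open>totient n\<close>. Its Fourier averages \<open>g k\<close> over the powers of u are zero or
  eigenvectors, and they add up to N h, so one of them is nonzero. Units are treated one after
  another.\<close>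

lemma common_eigenvector:
  fixes n :: nat and V :: "(int \<Rightarrow> complex) set"
  assumes n: "n > 0"
    and cong: "\<And>h x y. h \<in> V \<Longrightarrow> [x = y] (mod int n) \<Longrightarrow> h x = h y"
    and lin: "\<And>N c H. (\<And>j. H j \<in> V) \<Longrightarrow> (\<lambda>x. \<Sum>j<N::nat. c j * H j x) \<in> V"
    and trans: "\<And>h u. h \<in> V \<Longrightarrow> coprime u (int n) \<Longrightarrow> (\<lambda>x. h (u * x)) \<in> V"
    and h0: "h0 \<in> V" "h0 x0 \<noteq> 0"
  shows "\<exists>h\<in>V. (\<exists>x. h x \<noteq> 0) \<and> (\<forall>u. coprime u (int n) \<longrightarrow> (\<exists>l. \<forall>x. h (u * x) = l * h x))"
proof -
  have finite_case: "\<exists>h\<in>V. (\<exists>x. h x \<noteq> 0) \<and> (\<forall>u\<in>U. \<exists>l. \<forall>x. h (int u * x) = l * h x)"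
    if "finite U" "\<And>u. u \<in> U \<Longrightarrow> coprime u n" for U :: "nat set"
    using that
  proof (induction U rule: finite_induct)
    case empty
    then show ?case using h0 by auto
  next
    case (insert u U)
    then obtain h y where h: "h \<in> V" "h y \<noteq> 0" "\<forall>v\<in>U. \<exists>l. \<forall>x. h (int v * x) = l * h x" by auto
    define N where "N = totient n"
    have N: "N > 0" using n by (simp add: N_def)
    have u: "coprime u n" using insert.prems by simp
    have uN: "[int u ^ N = 1] (mod int n)"
      using euler_theorem[OF u] by (metis N_def cong_int_iff of_nat_1 of_nat_power)
    have period: "h (int u ^ N * x) = h x" for x
      using cong[OF h(1) cong_mult[OF uN cong_refl[of x]]] by simp
    define c where "c = (\<lambda>k j. cis (2 * pi * real k * real_of_int (- int j) / real N))"
    define g where "g = (\<lambda>k x. \<Sum>j<N. c k j * h (int u ^ j * x))"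
    have gV: "g k \<in> V" for k
      unfolding g_def by (intro lin trans h) (use u in simp)
    have "(\<Sum>k<N. g k y) = (\<Sum>j<N. (\<Sum>k<N. c k j) * h (int u ^ j * y))"
      unfolding g_def by (subst sum.swap) (simp add: sum_distrib_right)
    also have "\<dots> = (\<Sum>j<N. if j = 0 then of_nat N * h y else 0)"
    proof (intro sum.cong refl)
      fix j assume j: "j \<in> {..<N}"
      have "int N dvd - int j \<longleftrightarrow> j = 0" using j by (auto dest: dvd_imp_le)
      then show "(\<Sum>k<N. c k j) * h (int u ^ j * y) = (if j = 0 then of_nat N * h y else 0)"
        unfolding c_def sum_cis_residues[OF N] by simp
    qed
    also have "\<dots> = of_nat N * h y" using N by simp
    finally have "(\<Sum>k<N. g k y) \<noteq> 0" using N h(2) by simp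
    then obtain k where k: "g k y \<noteq> 0" by (meson sum.neutral)
    have eig: "g k (int u * x) = cis (2 * pi * real k / real N) * g k x" for x
    proof -
      define F where "F = (\<lambda>j. c k j * h (int u ^ j * x))"
      have FN: "F N = F 0"
      proof -
        have "2 * pi * real k * real_of_int (- int N) / real N = 2 * pi * real_of_int (- int k)"
          using N by simp
        then have "c k N = 1" unfolding c_def using cis_multiple_2pi[of "of_int (- int k)"] by simp
        then show ?thesis by (simp add: F_def c_def period)
      qed
      have shift: "c k j = cis (2 * pi * real k / real N) * c k (Suc j)" for j
      proof -
        have "2 * pi * real k * real_of_int (- int j) / real N =
            2 * pi * real k / real N + 2 * pi * real k * real_of_int (- int (Suc j)) / real N"
          using N by (simp add: field_simps)
        then show ?thesis unfolding c_def cis_mult by (simp only:)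
      qed
      have "c k j * h (int u ^ j * (int u * x)) = cis (2 * pi * real k / real N) * F (Suc j)" for j
        by (subst shift) (simp add: F_def mult_ac)
      then have "g k (int u * x) = cis (2 * pi * real k / real N) * (\<Sum>j<N. F (Suc j))"
        by (simp add: g_def sum_distrib_left)
      also have "(\<Sum>j<N. F (Suc j)) = (\<Sum>j<N. F j)"
        using FN sum.lessThan_Suc_shift[of F N] by simp
      finally show ?thesis by (simp add: g_def F_def)
    qed
    \<comment> \<open>The operators commute, so the projection for u keeps the eigenvalues already
      obtained for the units in U.\<close>
    have "\<exists>l. \<forall>x. g k (int v * x) = l * g k x" if v: "v \<in> U" for v
    proof -
      obtain l where l: "\<And>x. h (int v * x) = l * h x" using h(3) v by blast
      have "h (int u ^ j * (int v * x)) = l * h (int u ^ j * x)" for j x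
        using l[of "int u ^ j * x"] by (simp add: mult_ac)
      then show ?thesis by (intro exI[of _ l]) (simp add: g_def sum_distrib_left mult_ac)
    qed
    then show ?case using gV[of k] k eig by blast
  qed
  \<comment> \<open>Finitely many representatives suffice because functions in V depend on residues
    only.\<close>
  have "\<exists>h\<in>V. (\<exists>x. h x \<noteq> 0) \<and> (\<forall>u\<in>{u. u < n \<and> coprime u n}. \<exists>l. \<forall>x. h (int u * x) = l * h x)"
    by (rule finite_case) simp_all
  then obtain h where h: "h \<in> V" "\<exists>x. h x \<noteq> 0"
    "\<And>u. u < n \<Longrightarrow> coprime u n \<Longrightarrow> \<exists>l. \<forall>x. h (int u * x) = l * h x" by blast
  have "\<exists>l. \<forall>x. h (u * x) = l * h x" if u: "coprime u (int n)" for u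
  proof -
    define v where "v = nat (u mod int n)"
    have v: "int v = u mod int n" using n by (simp add: v_def)
    have "v < n" using v n by (metis of_nat_0_less_iff of_nat_less_iff pos_mod_bound)
    moreover have "coprime v n"
      using u by (metis v coprime_int_iff coprime_mod_left_iff n not_gr_zero of_nat_eq_0_iff)
    ultimately obtain l where l: "\<And>x. h (int v * x) = l * h x" using h(3) by blast
    have "h (u * x) = h (int v * x)" for x
      unfolding v by (intro cong[OF h(1)] cong_mult cong_refl) (simp add: Cong.cong_def)
    then show ?thesis using l by auto
  qed
  then show ?thesis using h(1,2) by blast
qed

text \<open>At multiples of n the value is 1/2 rather than the customary 0, so oddness holds only
  away from them.\<close>

definition sawtooth :: "nat \<Rightarrow> int \<Rightarrow> real" where
  "sawtooth n m = 1 / 2 - frac (real_of_int m / real n)"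

lemma sawtooth_cong:
  assumes "n > 0" "[x = y] (mod int n)"
  shows "sawtooth n x = sawtooth n y"
proof -
  obtain k where "x = y + int n * k" using assms(2) cong_iff_lin cong_sym by blast
  then have "real_of_int x / real n = real_of_int y / real n + real_of_int k"
    using assms(1) by (simp add: field_simps)
  then show ?thesis by (simp add: sawtooth_def frac_def)
qed

lemma sawtooth_minus:
  assumes "n > 0" "\<not> int n dvd m"
  shows "sawtooth n (- m) = - sawtooth n m"
proof -
  have "real_of_int m / real n \<notin> \<int>"
  proof
    assume "real_of_int m / real n \<in> \<int>"
    then obtain k where "real_of_int m / real n = of_int k" by (elim Ints_cases)
    then have "real_of_int m = real_of_int (k * int n)" using assms(1) by (simp add: field_simps)
    then have "m = k * int n" by (simp only: of_int_eq_iff)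
    then show False using assms(2) by simp
  qed
  then show ?thesis by (simp add: sawtooth_def frac_neg)
qed

lemma bij_betw_mult_residues:
  assumes n: "n > 0" and u: "coprime u (int n)"
  shows "bij_betw (\<lambda>b. u * b mod int n) {0..<int n} {0..<int n}"
proof -
  have inj: "inj_on (\<lambda>b. u * b mod int n) {0..<int n}"
  proof (rule inj_onI)
    fix x y assume xy: "x \<in> {0..<int n}" "y \<in> {0..<int n}" "u * x mod int n = u * y mod int n"
    then have "[u * x = u * y] (mod int n)" by (simp add: Cong.cong_def)
    then have "[x = y] (mod int n)" using u cong_mult_lcancel by blast
    then show "x = y" using xy by (simp add: Cong.cong_def)
  qed
  moreover have "(\<lambda>b. u * b mod int n) ` {0..<int n} = {0..<int n}"
    by (rule endo_inj_surj[OF _ _ inj]) (use n in auto)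
  ultimately show ?thesis by (simp add: bij_betw_def)
qed

text \<open>The hypotheses define a space closed under linear combinations and multiplication of the
  argument by units. A common eigenvector g has eigenvalue g(u)/g(1) at a unit u, so g divided by
  g(1) is multiplicative, an odd character with vanishing sawtooth sums.\<close>

theorem odd_function_sawtooth_sums_zero:
  fixes h :: "int \<Rightarrow> complex"
  assumes n: "n > 0"
    and cong: "\<And>x y. [x = y] (mod int n) \<Longrightarrow> h x = h y"
    and supp: "\<And>x. \<not> coprime x (int n) \<Longrightarrow> h x = 0"
    and odd: "\<And>x. h (- x) = - h x"
    and vanish: "\<And>t. \<not> int n dvd t \<Longrightarrow> (\<Sum>b\<in>{0..<int n}. h b * of_real (sawtooth n (t * b))) = 0"
  shows "h x = 0"
proof (rule ccontr)
  assume hx: "h x \<noteq> 0"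
  define V where "V = {h :: int \<Rightarrow> complex.
    (\<forall>x y. [x = y] (mod int n) \<longrightarrow> h x = h y) \<and> (\<forall>x. \<not> coprime x (int n) \<longrightarrow> h x = 0) \<and>
    (\<forall>x. h (- x) = - h x) \<and>
    (\<forall>t. \<not> int n dvd t \<longrightarrow> (\<Sum>b\<in>{0..<int n}. h b * of_real (sawtooth n (t * b))) = 0)}"
  have "\<exists>h\<in>V. (\<exists>x. h x \<noteq> 0) \<and> (\<forall>u. coprime u (int n) \<longrightarrow> (\<exists>l. \<forall>x. h (u * x) = l * h x))"
  proof (rule common_eigenvector[OF n])
    show "h \<in> V" unfolding V_def using cong supp odd vanish by auto
    show "h x \<noteq> 0" by (rule hx)
    show "g x = g y" if "g \<in> V" "[x = y] (mod int n)" for g x y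
      using that unfolding V_def by blast
    show "(\<lambda>x. \<Sum>j<N. c j * H j x) \<in> V" if H: "\<And>j. H j \<in> V" for N :: nat and c H
    proof -
      have 1: "\<And>j x y. [x = y] (mod int n) \<Longrightarrow> H j x = H j y"
        and 2: "\<And>j x. \<not> coprime x (int n) \<Longrightarrow> H j x = 0"
        and 3: "\<And>j x. H j (- x) = - H j x"
        and 4: "\<And>j t. \<not> int n dvd t \<Longrightarrow> (\<Sum>b\<in>{0..<int n}. H j b * of_real (sawtooth n (t * b))) = 0"
        using H unfolding V_def by blast+
      have "(\<Sum>b\<in>{0..<int n}. (\<Sum>j<N. c j * H j b) * of_real (sawtooth n (t * b))) = 0"
        if t: "\<not> int n dvd t" for t
      proof -
        have "(\<Sum>b\<in>{0..<int n}. (\<Sum>j<N. c j * H j b) * of_real (sawtooth n (t * b))) =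
            (\<Sum>j<N. c j * (\<Sum>b\<in>{0..<int n}. H j b * of_real (sawtooth n (t * b))))"
          by (simp only: sum_distrib_left sum_distrib_right mult.assoc) (rule sum.swap)
        then show ?thesis using 4[OF t] by simp
      qed
      moreover have "(\<Sum>j<N. c j * H j x) = (\<Sum>j<N. c j * H j y)" if "[x = y] (mod int n)" for x y
        using 1[OF that] by simp
      ultimately show ?thesis unfolding V_def using 2 3 by (auto simp: sum_negf)
    qed
    show "(\<lambda>x. g (u * x)) \<in> V" if g: "g \<in> V" and u: "coprime u (int n)" for g u
    proof -
      have 1: "\<And>x y. [x = y] (mod int n) \<Longrightarrow> g x = g y"
        and 2: "\<And>x. \<not> coprime x (int n) \<Longrightarrow> g x = 0"
        and 3: "\<And>x. g (- x) = - g x"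
        and 4: "\<And>t. \<not> int n dvd t \<Longrightarrow> (\<Sum>b\<in>{0..<int n}. g b * of_real (sawtooth n (t * b))) = 0"
        using g unfolding V_def by blast+
      \<comment> \<open>Reindexing by the inverse v of u moves the factor from g to the sawtooth,
        replacing t by t v, which is again not divisible by n.\<close>
      obtain v where v: "[u * v = 1] (mod int n)" using cong_solve_coprime_int[OF u] by auto
      have cv: "coprime v (int n)"
        using v by (metis coprime_1_left coprime_mult_left_iff cong_imp_coprime cong_sym)
      have "(\<Sum>b\<in>{0..<int n}. g (u * b) * of_real (sawtooth n (t * b))) = 0"
        if t: "\<not> int n dvd t" for t
      proof -
        have "(\<Sum>b\<in>{0..<int n}. g (u * b) * of_real (sawtooth n (t * b))) =
          (\<Sum>b\<in>{0..<int n}. g (u * (v * b mod int n)) * of_real (sawtooth n (t * (v * b mod int n))))"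
          by (rule sum.reindex_bij_betw[OF bij_betw_mult_residues[OF n cv], symmetric])
        also have "\<dots> = (\<Sum>b\<in>{0..<int n}. g b * of_real (sawtooth n (t * v * b)))"
        proof (intro sum.cong refl)
          fix b
          have "[u * (v * b mod int n) = u * (v * b)] (mod int n)"
            by (intro cong_mult cong_refl) (simp add: Cong.cong_def)
          also have "[u * (v * b) = 1 * b] (mod int n)"
            unfolding mult.assoc[symmetric] by (intro cong_mult cong_refl v)
          finally have A: "g (u * (v * b mod int n)) = g b" by (intro 1) simp
          have "[t * (v * b mod int n) = t * (v * b)] (mod int n)"
            by (intro cong_mult cong_refl) (simp add: Cong.cong_def)
          then have "sawtooth n (t * (v * b mod int n)) = sawtooth n (t * v * b)"
            unfolding mult.assoc by (rule sawtooth_cong[OF n])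
          then show "g (u * (v * b mod int n)) * of_real (sawtooth n (t * (v * b mod int n))) =
              g b * of_real (sawtooth n (t * v * b))" using A by simp
        qed
        also have "\<dots> = 0"
          using t cv by (intro 4) (simp add: coprime_dvd_mult_left_iff coprime_commute)
        finally show ?thesis .
      qed
      moreover have "g (u * x) = g (u * y)" if "[x = y] (mod int n)" for x y
        by (intro 1 cong_mult cong_refl that)
      moreover have "g (u * x) = 0" if "\<not> coprime x (int n)" for x
        using that by (intro 2) simp
      ultimately show ?thesis unfolding V_def using 3 by auto
    qed
  qed
  then obtain g y where g: "g \<in> V" "g y \<noteq> 0" and eig: "\<And>u. coprime u (int n) \<Longrightarrow> \<exists>l. \<forall>x. g (u * x) = l * g x"
    by blast
  have 1: "\<And>x y. [x = y] (mod int n) \<Longrightarrow> g x = g y"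
    and 2: "\<And>x. \<not> coprime x (int n) \<Longrightarrow> g x = 0"
    and 3: "\<And>x. g (- x) = - g x"
    and 4: "\<And>t. \<not> int n dvd t \<Longrightarrow> (\<Sum>b\<in>{0..<int n}. g b * of_real (sawtooth n (t * b))) = 0"
    using g unfolding V_def by blast+
  have g1: "g 1 \<noteq> 0"
  proof -
    have "coprime y (int n)" using 2 g(2) by blast
    then obtain l where "\<forall>x. g (y * x) = l * g x" using eig by blast
    then have "g (y * 1) = l * g 1" by blast
    then show ?thesis using g(2) by auto
  qed
  have g_mult: "g (u * x) * g 1 = g u * g x" for u x
  proof (cases "coprime u (int n)")
    case True
    then obtain l where l: "\<forall>x. g (u * x) = l * g x" using eig by blast
    then have "g (u * 1) = l * g 1" by blast
    then show ?thesis using l by simp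
  qed (simp add: 2)
  define \<psi> where "\<psi> = (\<lambda>k. g (int k) / g 1)"
  interpret dirichlet_character n \<psi>
  proof
    show "n > 0" by (rule n)
    show "\<psi> 1 = 1" using g1 by (simp add: \<psi>_def)
    show "\<psi> (j * k) = \<psi> j * \<psi> k" for j k
      using g_mult[of "int j" "int k"] g1 by (simp add: \<psi>_def field_simps)
    show "\<psi> (k + n) = \<psi> k" for k
      using 1[of "int (k + n)" "int k"] by (simp add: \<psi>_def Cong.cong_def)
    show "\<psi> k = 0" if "\<not> coprime k n" for k
      using 2[of "int k"] that by (simp add: \<psi>_def)
  qed
  show False
  proof (rule odd_character_sawtooth_sum_nonzero)
    have "[int (n - 1) = - 1] (mod int n)" using n by (simp add: cong_iff_dvd_diff of_nat_diff)
    then have "g (int (n - 1)) = - g 1" using 1 3[of 1] by metis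
    then show "\<psi> (n - 1) = - 1" using g1 by (simp add: \<psi>_def)
    fix t assume t: "t \<in> {1..<n}"
    then have "\<not> int n dvd int t" by (auto dest: dvd_imp_le)
    then have "(\<Sum>b\<in>{0..<int n}. g b * of_real (sawtooth n (int t * b))) = 0" by (rule 4)
    also have "{0..<int n} = int ` {..<n}"
      by (metis atLeast0LessThan image_int_atLeastLessThan of_nat_0)
    finally have "(\<Sum>a<n. g (int a) * of_real (sawtooth n (int t * int a))) = 0"
      by (simp add: sum.reindex)
    then have "(\<Sum>a<n. g (int a) * of_real (sawtooth n (int t * int a))) / g 1 = 0" by simp
    then show "(\<Sum>a<n. \<psi> a * of_real (1 / 2 - frac (real t * real a / real n))) = 0"
      by (simp add: \<psi>_def sawtooth_def sum_divide_distrib)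
  qed
qed

section \<open>Pairing\<close>

text \<open>Pairs are split off by induction, with I arbitrary for that purpose. Normally i
  contributes 1 to the balance at c = \<open>a i\<close>, so some other j must contribute -1, which
  says that \<open>a j\<close> is opposite to \<open>a i\<close>.\<close>

lemma pairing_of_balanced:
  fixes n :: nat and a :: "nat \<Rightarrow> int"
  assumes "finite I" "card I = 2 * d"
    and "\<And>i. i \<in> I \<Longrightarrow> coprime (a i) (int n)"
    and "\<And>c. (\<Sum>i\<in>I. of_bool ([a i = c] (mod int n)) - of_bool ([a i = - c] (mod int n)) :: int) = 0"
  shows "\<exists>q. bij_betw q {1..2 * d} I \<and> (\<forall>i\<in>{1..d}. [a (q (2 * i - 1)) = - a (q (2 * i))] (mod int n))"
  using assms
proof (induction d arbitrary: I)
  case 0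
  then show ?case by (auto simp: bij_betw_def)
next
  case (Suc d)
  define f where "f = (\<lambda>c i. of_bool ([a i = c] (mod int n)) - of_bool ([a i = - c] (mod int n)) :: int)"
  have bal: "(\<Sum>i\<in>I. f c i) = 0" for c using Suc.prems(4) by (simp add: f_def)
  obtain i where i: "i \<in> I" using Suc.prems(1,2) by fastforce
  have "\<exists>j\<in>I - {i}. [a j = - a i] (mod int n)"
  \<comment> \<open>A residue equal to its own negative contributes 0 to every balance. Being a
    unit, it forces n to divide 2, and then all units are congruent and any other index
    serves.\<close>
  proof (cases "[a i = - a i] (mod int n)")
    case True
    then have "int n dvd a i * 2" by (simp add: cong_iff_dvd_diff mult.commute)
    then have "int n dvd 2"
      using Suc.prems(3)[OF i] coprime_dvd_mult_right_iff coprime_commute by blast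
    then have n2: "n dvd 2" by (metis int_dvd_int_iff of_nat_numeral)
    have "card (I - {i}) > 0" using Suc.prems(1,2) i by simp
    then obtain j where j: "j \<in> I - {i}" by (metis card_gt_0_iff ex_in_conv)
    have "n \<le> 2" "n > 0" using n2 dvd_imp_le[of n 2] by (auto intro: Nat.gr0I)
    then consider "n = 1" | "n = 2" by linarith
    then have "[a j = - a i] (mod int n)"
    proof cases
      case 2
      then have "odd (a j)" "odd (a i)" using Suc.prems(3) i j by auto
      then show ?thesis using 2 by (simp add: cong_iff_dvd_diff)
    qed (simp add: Cong.cong_def)
    then show ?thesis using j by blast
  next
    case False
    have "f (a i) i = 1" using False by (simp add: f_def)
    moreover have "(\<Sum>j\<in>I. f (a i) j) = f (a i) i + (\<Sum>j\<in>I - {i}. f (a i) j)"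
      by (rule sum.remove[OF Suc.prems(1) i])
    ultimately have "(\<Sum>j\<in>I - {i}. f (a i) j) < 0" using bal[of "a i"] by simp
    then obtain j where "j \<in> I - {i}" "f (a i) j < 0" by (meson not_less sum_nonneg)
    then show ?thesis by (auto simp: f_def of_bool_def split: if_splits)
  qed
  then obtain j where j: "j \<in> I" "j \<noteq> i" "[a j = - a i] (mod int n)" by blast
  define J where "J = I - {i, j}"
  have cancel: "f c i + f c j = 0" for c
  proof -
    have "[a j = c] (mod int n) \<longleftrightarrow> [- a i = c] (mod int n)"
      using j(3) cong_sym cong_trans by meson
    also have "\<dots> \<longleftrightarrow> [a i = - c] (mod int n)"
      using cong_minus_minus_iff[of "a i" "- c" "int n"] by simp
    finally have A: "[a j = c] (mod int n) \<longleftrightarrow> [a i = - c] (mod int n)" .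
    have "[a j = - c] (mod int n) \<longleftrightarrow> [- a i = - c] (mod int n)"
      using j(3) cong_sym cong_trans by meson
    then show ?thesis using A by (simp add: f_def cong_minus_minus_iff)
  qed
  have "(\<Sum>k\<in>J. f c k) = 0" for c
  proof -
    have "(\<Sum>k\<in>I. f c k) = (\<Sum>k\<in>J. f c k) + (\<Sum>k\<in>{i, j}. f c k)"
      unfolding J_def using Suc.prems(1) i j by (intro sum.subset_diff) auto
    then show ?thesis using bal[of c] cancel[of c] j(2) by simp
  qed
  moreover have "finite J" "card J = 2 * d"
    using Suc.prems(1,2) i j by (simp_all add: J_def card_Diff_subset)
  moreover have "\<And>k. k \<in> J \<Longrightarrow> coprime (a k) (int n)" using Suc.prems(3) by (simp add: J_def)
  ultimately obtain q where q: "bij_betw q {1..2 * d} J"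
    "\<And>k. k \<in> {1..d} \<Longrightarrow> [a (q (2 * k - 1)) = - a (q (2 * k))] (mod int n)"
    using Suc.IH[of J] unfolding f_def by blast
  define q' where "q' = q(2 * d + 1 := j, 2 * d + 2 := i)"
  have "bij_betw q' ({1..2 * d} \<union> {2 * d + 1, 2 * d + 2}) (J \<union> {j, i})"
  proof (rule bij_betw_combine)
    show "bij_betw q' {1..2 * d} J"
      using q(1) by (subst bij_betw_cong[of _ _ q]) (auto simp: q'_def)
    show "bij_betw q' {2 * d + 1, 2 * d + 2} {j, i}"
      using j(2) by (auto simp: bij_betw_def q'_def)
  qed (auto simp: J_def)
  moreover have "{1..2 * d} \<union> {2 * d + 1, 2 * d + 2} = {1..2 * Suc d}" by auto
  moreover have "J \<union> {j, i} = I" using i j by (auto simp: J_def)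
  moreover have "[a (q' (2 * k - 1)) = - a (q' (2 * k))] (mod int n)" if k: "k \<in> {1..Suc d}" for k
  proof (cases "k = Suc d")
    case True
    then show ?thesis using j(3) by (simp add: q'_def)
  next
    case False
    then have kd: "k \<in> {1..d}" using k by auto
    then have "q' (2 * k - 1) = q (2 * k - 1)" "q' (2 * k) = q (2 * k)" by (auto simp: q'_def)
    then show ?thesis using q(2)[OF kd] by simp
  qed
  ultimately show ?case by (intro exI[of _ q']) auto
qed

lemma sum_over_pairs:
  fixes f :: "nat \<Rightarrow> real"
  shows "(\<Sum>i=1..2 * d. f i) = (\<Sum>i=1..d. f (2 * i - 1) + f (2 * i))"
  by (induction d) auto

theorem theorem1p12:
  fixes d n :: nat and a :: "nat \<Rightarrow> int"
  assumes "d \<ge> 1" and "n \<ge> 1"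
    and "\<And>i. i \<in> {1..2 * d} \<Longrightarrow> gcd (a i) (int n) = 1"
    and "(\<Sum>i = 1..2 * d. real_of_int (a i) / real n) \<in> \<int>"
  shows "min_log_discrepancy (2 * d) n a \<ge> ereal (real d) \<longleftrightarrow>
    (\<exists>p. p permutes {1..2 * d} \<and>
         (\<forall>i\<in>{1..d}. [a (p (2 * i - 1)) = - a (p (2 * i))] (mod int n)))"
proof -
  have n: "n > 0" using assms(2) by simp
  have cop: "coprime (a i) (int n)" if "i \<in> {1..2 * d}" for i
    using assms(3)[OF that] by (simp add: coprime_iff_gcd_eq_1)
  have ndvd: "\<not> int n dvd t * a i" if "i \<in> {1..2 * d}" "\<not> int n dvd t" for i t
    using cop[OF that(1)] that(2) by (simp add: coprime_commute coprime_dvd_mult_left_iff)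
  \<comment> \<open>The 2 d halves add up to d, so the bound by d says that the sawtooth sum is at
    most 0.\<close>
  have frac_sum: "(\<Sum>i=1..2 * d. frac (real t * real_of_int (a i) / real n)) =
      real d - (\<Sum>i=1..2 * d. sawtooth n (int t * a i))" for t
    by (simp add: sawtooth_def sum_subtractf)
  show ?thesis
  proof
    assume mld: "ereal (real d) \<le> min_log_discrepancy (2 * d) n a"
    \<comment> \<open>Extended from 1, ..., n - 1 to all integers not divisible by n, so that -t can
      take the place of n - t.\<close>
    have le: "(\<Sum>i=1..2 * d. sawtooth n (t * a i)) \<le> 0" if t: "\<not> int n dvd t" for t
    proof -
      define s where "s = nat (t mod int n)"
      have s: "int s = t mod int n" using n by (simp add: s_def)
      have "s \<in> {1..n - 1}"
      proof -
        have "int s < int n" "int s \<noteq> 0" using s n t by (simp_all add: dvd_eq_mod_eq_0)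
        then show ?thesis by auto
      qed
      then have "(\<Sum>i=1..2 * d. sawtooth n (int s * a i)) \<le> 0"
        using mld frac_sum[of s] unfolding le_min_log_discrepancy_iff by fastforce
      moreover have "sawtooth n (int s * a i) = sawtooth n (t * a i)" for i
        unfolding s by (intro sawtooth_cong[OF n] cong_mult cong_refl) (simp add: Cong.cong_def)
      ultimately show ?thesis by simp
    qed
    have saw0: "(\<Sum>i=1..2 * d. sawtooth n (t * a i)) = 0" if t: "\<not> int n dvd t" for t
    proof -
      have "(\<Sum>i=1..2 * d. sawtooth n (- t * a i)) = - (\<Sum>i=1..2 * d. sawtooth n (t * a i))"
        unfolding sum_negf[symmetric]
        using sawtooth_minus[OF n ndvd[OF _ t]] by (intro sum.cong) auto
      then show ?thesis using le[OF t] le[of "- t"] t by simp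
    qed
    \<comment> \<open>Complex-valued because characters are sought in its orbit; the integer balance
      is recovered from it at the end.\<close>
    define h where "h = (\<lambda>c. \<Sum>i=1..2 * d. of_bool ([a i = c] (mod int n)) - of_bool ([a i = - c] (mod int n)) :: complex)"
    have h0: "h c = 0" for c
    proof (rule odd_function_sawtooth_sums_zero[OF n])
      show "h x = h y" if xy: "[x = y] (mod int n)" for x y
      proof -
        have "[a i = x] (mod int n) \<longleftrightarrow> [a i = y] (mod int n)" for i
          using xy cong_sym cong_trans by meson
        moreover have "[a i = - x] (mod int n) \<longleftrightarrow> [a i = - y] (mod int n)" for i
          using xy cong_minus_minus_iff cong_sym cong_trans by meson
        ultimately show ?thesis by (simp add: h_def)
      qed
      show "h x = 0" if x: "\<not> coprime x (int n)" for x
      proof -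
        have "\<not> [a i = x] (mod int n)" "\<not> [a i = - x] (mod int n)" if "i \<in> {1..2 * d}" for i
          using cop[OF that] x cong_imp_coprime[of "a i" x "int n"] cong_imp_coprime[of "a i" "- x" "int n"] by auto
        then show ?thesis by (simp add: h_def)
      qed
      show "h (- x) = - h x" for x
        unfolding h_def sum_negf[symmetric] by (intro sum.cong) auto
      fix t assume t: "\<not> int n dvd t"
      have pick: "(\<Sum>b\<in>{0..<int n}. of_bool ([e = b] (mod int n)) * complex_of_real (sawtooth n (t * b))) =
          of_real (sawtooth n (t * e))" for e
      proof -
        have "(\<Sum>b\<in>{0..<int n}. of_bool ([e = b] (mod int n)) * complex_of_real (sawtooth n (t * b))) =
            (\<Sum>b\<in>{0..<int n}. if b = e mod int n then complex_of_real (sawtooth n (t * b)) else 0)"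
          by (intro sum.cong) (auto simp: Cong.cong_def)
        also have "\<dots> = of_real (sawtooth n (t * (e mod int n)))" using n by simp
        also have "sawtooth n (t * (e mod int n)) = sawtooth n (t * e)"
          by (intro sawtooth_cong[OF n] cong_mult cong_refl) (simp add: Cong.cong_def)
        finally show ?thesis .
      qed
      have flip: "[e = - b] (mod int n) \<longleftrightarrow> [- e = b] (mod int n)" for e b
        using cong_minus_minus_iff[of e "- b" "int n"] by simp
      have "(\<Sum>b\<in>{0..<int n}. h b * of_real (sawtooth n (t * b))) =
          (\<Sum>i=1..2 * d. (\<Sum>b\<in>{0..<int n}. of_bool ([a i = b] (mod int n)) * complex_of_real (sawtooth n (t * b))) -
            (\<Sum>b\<in>{0..<int n}. of_bool ([- a i = b] (mod int n)) * complex_of_real (sawtooth n (t * b))))"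
        unfolding h_def sum_distrib_right flip left_diff_distrib sum_subtractf[symmetric] by (rule sum.swap)
      also have "\<dots> = (\<Sum>i=1..2 * d. of_real (sawtooth n (t * a i)) - of_real (sawtooth n (t * - a i)))"
        unfolding pick ..
      \<comment> \<open>Both halves of h give the same sum, since the sawtooth is odd at t times
        \<open>a i\<close>.\<close>
      also have "\<dots> = (\<Sum>i=1..2 * d. of_real (2 * sawtooth n (t * a i)))"
        using sawtooth_minus[OF n ndvd[OF _ t]] by (intro sum.cong) auto
      also have "\<dots> = of_real (2 * (\<Sum>i=1..2 * d. sawtooth n (t * a i)))"
        by (simp add: sum_distrib_left)
      also have "\<dots> = 0" by (simp only: saw0[OF t] mult_zero_right of_real_0)
      finally show "(\<Sum>b\<in>{0..<int n}. h b * of_real (sawtooth n (t * b))) = 0" .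
    qed
    have "(\<Sum>i=1..2 * d. of_bool ([a i = c] (mod int n)) - of_bool ([a i = - c] (mod int n)) :: int) = 0" for c
    proof -
      have "of_int (\<Sum>i=1..2 * d. of_bool ([a i = c] (mod int n)) - of_bool ([a i = - c] (mod int n)) :: int) = h c"
        by (simp only: h_def of_int_sum of_int_diff of_int_of_bool)
      then show ?thesis using h0[of c] by (simp only: of_int_eq_0_iff)
    qed
    then obtain q where q: "bij_betw q {1..2 * d} {1..2 * d}"
      "\<And>i. i \<in> {1..d} \<Longrightarrow> [a (q (2 * i - 1)) = - a (q (2 * i))] (mod int n)"
      using pairing_of_balanced[of "{1..2 * d}" d a n] cop by auto
    \<comment> \<open>\<open>permutes\<close> demands the identity outside the index set, on which
      nothing is known about q.\<close>
    define p where "p = (\<lambda>i. if i \<in> {1..2 * d} then q i else i)"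
    have "bij_betw p {1..2 * d} {1..2 * d}"
      using q(1) by (subst bij_betw_cong[of _ _ q]) (auto simp: p_def)
    then have "p permutes {1..2 * d}" by (rule bij_imp_permutes) (auto simp: p_def)
    moreover have "\<forall>i\<in>{1..d}. [a (p (2 * i - 1)) = - a (p (2 * i))] (mod int n)"
      using q(2) by (auto simp: p_def)
    ultimately show "\<exists>p. p permutes {1..2 * d} \<and>
        (\<forall>i\<in>{1..d}. [a (p (2 * i - 1)) = - a (p (2 * i))] (mod int n))" by blast
  next
    assume "\<exists>p. p permutes {1..2 * d} \<and> (\<forall>i\<in>{1..d}. [a (p (2 * i - 1)) = - a (p (2 * i))] (mod int n))"
    then obtain p where p: "p permutes {1..2 * d}"
      "\<And>i. i \<in> {1..d} \<Longrightarrow> [a (p (2 * i - 1)) = - a (p (2 * i))] (mod int n)" by blast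
    show "ereal (real d) \<le> min_log_discrepancy (2 * d) n a"
      unfolding le_min_log_discrepancy_iff frac_sum
    proof
      fix t assume t: "t \<in> {1..n - 1}"
      then have t': "\<not> int n dvd int t" by (auto dest: dvd_imp_le)
      have "(\<Sum>i=1..2 * d. sawtooth n (int t * a i)) = (\<Sum>i=1..2 * d. sawtooth n (int t * a (p i)))"
        using sum.permute[OF p(1), of "\<lambda>i. sawtooth n (int t * a i)"] by (simp add: o_def)
      also have "\<dots> = (\<Sum>i=1..d. sawtooth n (int t * a (p (2 * i - 1))) + sawtooth n (int t * a (p (2 * i))))"
        by (rule sum_over_pairs)
      also have "\<dots> = (\<Sum>i=1..d. 0)"
      proof (intro sum.cong refl)
        fix i assume i: "i \<in> {1..d}"
        have "[int t * a (p (2 * i - 1)) = int t * - a (p (2 * i))] (mod int n)"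
          by (intro cong_mult cong_refl p(2) i)
        then have "sawtooth n (int t * a (p (2 * i - 1))) = sawtooth n (- (int t * a (p (2 * i))))"
          using sawtooth_cong[OF n] by simp
        moreover have "p (2 * i) \<in> {1..2 * d}" using permutes_in_image[OF p(1), of "2 * i"] i by simp
        ultimately show "sawtooth n (int t * a (p (2 * i - 1))) + sawtooth n (int t * a (p (2 * i))) = 0"
          using sawtooth_minus[OF n ndvd[OF _ t']] by simp
      qed
      finally show "real d \<le> real d - (\<Sum>i=1..2 * d. sawtooth n (int t * a i))" by simp
    qed
  qed
qed

end
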